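(* Let $\Omega_0$ and $\Omega$ be closed and open sets, respectively, of the complex plane, with $\Omega_0\subset\Omega\subset\mathbb{C}$. Let $f(z)$ be an analytic function on $\Omega\setminus\Omega_0$. Let $z_1,\dots,z_p$ be $p$ different points with multiplicities $m_1,\dots,m_p$ (positive integers), such that $z_1,\dots,z_q\in\Omega\setminus\Omega_0$ and $z_{q+1},\dots,z_p\in\Omega_0$ ($q$ points are in $\Omega\setminus\Omega_0$ and $p-q$ points are in $\Omega_0$). Write $m=m_1+\dots+m_p$ and $s=m_1+\dots+m_q$. Then, for $z\in\Omega\setminus\Omega_0$, $f(z)$ has the Taylor-Laurent expansion $$f(z)=\sum_{n=0}^{N-1}q_{n,m}(z)\prod_{k=1}^p(z-z_k)^{nm_k}+\sum_{n=0}^{N-1}t^{(1)}_{n,m}(z)\frac{\prod_{k=1}^q(z-z_k)^{nm_k}}{\prod_{k=q+1}^p(z-z_k)^{nm_k}}+\sum_{n=0}^{N-1}t^{(2)}_{n,m}(z)\frac{\prod_{k=1}^q(z-z_k)^{(n+1)m_k}}{\prod_{k=q+1}^p(z-z_k)^{(n+1)m_k}}+r_N(z),$$ where $q_{n,m}(z)$ is the polynomial of degree $m-1$ $$q_{n,m}(z)=\sum_{j=1}^p\frac{\prod_{k=1,k\ne j}^p(z-z_k)^{m_k}}{\prod_{k=1,k\ne j}^p(z_j-z_k)^{m_k}}\sum_{l=0}^{m_j-1}a_{n,j,l}(z-z_j)^l,$$ with coefficients given by the Cauchy integral $$a_{n,j,l}=\frac{1}{2\pi i}\int_{\Gamma_1}\frac{f(w)\,dw}{(w-z_j)^{l+1}\prod_{k=1}^p(w-z_k)^{nm_k}}.$$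 Also, $t^{(1)}_{n,m}(z)$ and $t^{(2)}_{n,m}(z)$ are the following polynomials of degrees $s-1$ and $m-s-1$, respectively: $$t^{(1)}_{n,m}(z)=-\sum_{j=1}^q\frac{\prod_{k=1,k\ne j}^q(z-z_k)^{m_k}}{\prod_{k=1,k\ne j}^q(z_j-z_k)^{m_k}}\sum_{l=0}^{m_j-1}b_{n,j,l}(z-z_j)^l,$$ $$b_{n,j,l}=\frac{1}{2\pi i}\int_{\Gamma_2}\frac{\prod_{k=q+1}^p(w-z_k)^{nm_k}}{\prod_{k=1}^q(w-z_k)^{nm_k}}\,\frac{f(w)\,dw}{(w-z_j)^{l+1}},$$ $$t^{(2)}_{n,m}(z)=\sum_{j=q+1}^p\frac{\prod_{k=q+1,k\ne j}^p(z-z_k)^{m_k}}{\prod_{k=q+1,k\ne j}^p(z_j-z_k)^{m_k}}\sum_{l=0}^{m_j-1}c_{n,j,l}(z-z_j)^l,$$ $$c_{n,j,l}=\frac{1}{2\pi i}\int_{\Gamma_2}\frac{\prod_{k=q+1}^p(w-z_k)^{(n+1)m_k}}{\prod_{k=1}^q(w-z_k)^{(n+1)m_k}}\,\frac{f(w)\,dw}{(w-z_j)^{l+1}}.$$ The remainder term $r_N(z)$ is given by the Cauchy integrals $$r_N(z)=\frac{1}{2\pi i}\int_{\Gamma_1}\frac{f(w)\,dw}{(w-z)\prod_{k=1}^p(w-z_k)^{Nm_k}}\prod_{k=1}^p(z-z_k)^{Nm_k}-\frac{1}{2\pi i}\int_{\Gamma_2}\frac{\prod_{k=q+1}^p(w-z_k)^{Nm_k}}{\prod_{k=1}^q(w-z_k)^{Nm_k}}\,\frac{f(w)\,dw}{w-z}\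 \frac{\prod_{k=1}^q(z-z_k)^{Nm_k}}{\prod_{k=q+1}^p(z-z_k)^{Nm_k}}.$$ In these integrals, the contours of integration $\Gamma_1$ and $\Gamma_2$ are simple closed loops contained in $\Omega\setminus\Omega_0$ which encircle $\Omega_0$ in the counterclockwise direction. Moreover, the points $z$ and $z_1,\dots,z_q$ are not inside $\Gamma_2$, whereas $\Gamma_1$ encircles $\Gamma_2$ and the points $z$ and $z_1,\dots,z_q$. The expansion is convergent in the region $$D_{q,p}=\Big\{z\in\Omega\setminus\Omega_0:\ \prod_{k=1}^p|z-z_k|^{m_k}<r_1,\ \ \prod_{k=1}^q|z-z_k|^{m_k}<r_2\prod_{k=q+1}^p|z-z_k|^{m_k}\Big\},$$ where $$r_1=\inf_{w\in\mathbb{C}\setminus\Omega}\ \prod_{k=1}^p|w-z_k|^{m_k},\qquad r_2=\inf_{w\in\Omega_0}\ \prod_{k=1}^q|w-z_k|^{m_k}\prod_{k=q+1}^p|w-z_k|^{-m_k}.$$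
   Context: Empty sums are zero and empty products equal one. Convergence of the expansion means that $r_N(z)\to0$ as $N\to\infty$. If $\Omega=\mathbb{C}$, the infimum over the empty set is understood as $r_1=+\infty$; in the definition of $r_2$ the expression is read as $+\infty$ at $w=z_{q+1},\dots,z_p$.
   Formalization: In q, t1, t2 the sums over l also carry the truncated Taylor series at z_j of the reciprocal of the product factor (printed formula fails for multiple nodes); the interior of Γ1 is assumed to lie in Ω; "degree m-1, s-1, m-s-1" is read as "at most". *)

theory Defs
  imports "HOL-Complex_Analysis.Complex_Analysis"
begin

text \<open>
  The \<open>p\<close> nodes are \<open>pt 1, \<dots>, pt p\<close> with multiplicities \<open>\<mu> 1, \<dots>, \<mu> p\<close>; the nodes with
  index \<open>1, \<dots>, q\<close> lie in \<open>\<Omega> - \<Omega>0\<close>, the others in \<open>\<Omega>0\<close>.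
\<close>

definition node_prod :: "nat set \<Rightarrow> (nat \<Rightarrow> complex) \<Rightarrow> (nat \<Rightarrow> nat) \<Rightarrow> nat \<Rightarrow> complex \<Rightarrow> complex" where
  "node_prod K pt \<mu> n w = (\<Prod>k\<in>K. (w - pt k) ^ (n * \<mu> k))"

definition node_abs :: "nat set \<Rightarrow> (nat \<Rightarrow> complex) \<Rightarrow> (nat \<Rightarrow> nat) \<Rightarrow> complex \<Rightarrow> real" where
  "node_abs K pt \<mu> w = (\<Prod>k\<in>K. cmod (w - pt k) ^ \<mu> k)"

definition cofactor :: "nat set \<Rightarrow> (nat \<Rightarrow> complex) \<Rightarrow> (nat \<Rightarrow> nat) \<Rightarrow> nat \<Rightarrow> complex poly" where
  "cofactor K pt \<mu> j =
     smult (1 / (\<Prod>k\<in>K - {j}. (pt j - pt k) ^ \<mu> k)) (\<Prod>k\<in>K - {j}. [:- pt k, 1:] ^ \<mu> k)"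

text \<open>The \<open>i\<close>-th Taylor coefficient at \<open>pt j\<close> of the reciprocal of \<^term>\<open>cofactor K pt \<mu> j\<close>.\<close>

definition recip_coeff :: "nat set \<Rightarrow> (nat \<Rightarrow> complex) \<Rightarrow> (nat \<Rightarrow> nat) \<Rightarrow> nat \<Rightarrow> nat \<Rightarrow> complex" where
  "recip_coeff K pt \<mu> j i =
     (deriv ^^ i) (\<lambda>w. 1 / poly (cofactor K pt \<mu> j) w) (pt j) / fact i"

text \<open>
  The Hermite interpolation polynomial with Taylor coefficients \<open>c j l\<close> (\<open>l < \<mu> j\<close>) at the
  nodes \<open>pt j\<close> (\<open>j \<in> K\<close>).  The source prints the same sum without the innermost sum over \<open>i\<close>.
  That agrees with the present definition for simple nodes and for a single node (see the two
  lemmas below).  In general the printed polynomial does not have the Taylor coefficients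
  \<open>c j l\<close> at a multiple node, because the cofactor is not \<open>1\<close> to order \<open>\<mu> j\<close> there, and the
  expansion with it is false: for \<open>f = 1\<close> and the nodes \<open>1\<close> (double) and \<open>2\<close> (simple) in
  \<open>\<Omega> - \<Omega>0\<close> it would read \<open>1 = z\<^sup>2 - 3 * z + 3\<close> at \<open>N = 1\<close>.  The innermost sum is the reciprocal
  of the cofactor truncated to the order that matters.
\<close>

definition hermite_poly ::
  "nat set \<Rightarrow> (nat \<Rightarrow> complex) \<Rightarrow> (nat \<Rightarrow> nat) \<Rightarrow> (nat \<Rightarrow> nat \<Rightarrow> complex) \<Rightarrow> complex poly" where
  "hermite_poly K pt \<mu> c =
     (\<Sum>j\<in>K. cofactor K pt \<mu> j *
        (\<Sum>l<\<mu> j. smult (c j l) ([:- pt j, 1:] ^ l) *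
           (\<Sum>i<\<mu> j - l. smult (recip_coeff K pt \<mu> j i) ([:- pt j, 1:] ^ i))))"

lemma hermite_poly_simple_nodes:
  assumes "inj_on pt K" "\<And>j. j \<in> K \<Longrightarrow> \<mu> j = 1" "finite K"
  shows "hermite_poly K pt \<mu> c =
     (\<Sum>j\<in>K. cofactor K pt \<mu> j * (\<Sum>l<\<mu> j. smult (c j l) ([:- pt j, 1:] ^ l)))"
proof -
  have "poly (cofactor K pt \<mu> j) (pt j) = 1" if "j \<in> K" for j
    using that assms by (auto simp: cofactor_def poly_prod inj_on_def)
  then show ?thesis
    using assms by (auto simp: hermite_poly_def recip_coeff_def intro!: sum.cong)
qed

lemma hermite_poly_single_node:
  "hermite_poly {j} pt \<mu> c = (\<Sum>l<\<mu> j. smult (c j l) ([:- pt j, 1:] ^ l))"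
proof -
  have "recip_coeff {j} pt \<mu> j i = (if i = 0 then 1 else 0)" for i
    by (simp add: recip_coeff_def cofactor_def)
  then have "(\<Sum>i<\<mu> j - l. smult (recip_coeff {j} pt \<mu> j i) ([:- pt j, 1:] ^ i)) = 1"
    if "l < \<mu> j" for l
    using that by (subst sum.remove[of _ 0]) (auto intro!: sum.neutral)
  then show ?thesis
    by (simp add: hermite_poly_def cofactor_def)
qed

definition ccw_loop :: "(real \<Rightarrow> complex) \<Rightarrow> bool" where
  "ccw_loop \<Gamma> \<longleftrightarrow> valid_path \<Gamma> \<and> simple_path \<Gamma> \<and> pathfinish \<Gamma> = pathstart \<Gamma> \<and>
     (\<forall>w \<in> inside (path_image \<Gamma>). winding_number \<Gamma> w = 1)"

text \<open>
  The last conjunct of the \<open>\<Gamma>1\<close> clause excludes that \<open>\<Gamma>1\<close> winds around a point outside \<open>\<Omega>\<close>.  With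
  it, the region between the loops is contained in \<open>\<Omega> - \<Omega>0\<close>, as the Cauchy formula requires.
\<close>

definition admissible_loops ::
  "complex set \<Rightarrow> complex set \<Rightarrow> (nat \<Rightarrow> complex) \<Rightarrow> nat \<Rightarrow> complex \<Rightarrow>
   (real \<Rightarrow> complex) \<Rightarrow> (real \<Rightarrow> complex) \<Rightarrow> bool" where
  "admissible_loops \<Omega> \<Omega>0 pt q z \<Gamma>1 \<Gamma>2 \<longleftrightarrow>
     (ccw_loop \<Gamma>1 \<and> path_image \<Gamma>1 \<subseteq> \<Omega> - \<Omega>0 \<and>
      \<Omega>0 \<union> path_image \<Gamma>2 \<union> {z} \<union> pt ` {1..q} \<subseteq> inside (path_image \<Gamma>1) \<and>
      inside (path_image \<Gamma>1) \<subseteq> \<Omega>) \<and>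
     (ccw_loop \<Gamma>2 \<and> path_image \<Gamma>2 \<subseteq> \<Omega> - \<Omega>0 \<and>
      \<Omega>0 \<subseteq> inside (path_image \<Gamma>2) \<and>
      {z} \<union> pt ` {1..q} \<subseteq> outside (path_image \<Gamma>2))"

definition coeff_a ::
  "(complex \<Rightarrow> complex) \<Rightarrow> (real \<Rightarrow> complex) \<Rightarrow> (nat \<Rightarrow> complex) \<Rightarrow> (nat \<Rightarrow> nat) \<Rightarrow> nat \<Rightarrow>
   nat \<Rightarrow> nat \<Rightarrow> nat \<Rightarrow> complex" where
  "coeff_a f \<Gamma>1 pt \<mu> p n j l = 1 / (2 * of_real pi * \<i>) *
     contour_integral \<Gamma>1 (\<lambda>w. f w / ((w - pt j) ^ (l + 1) * node_prod {1..p} pt \<mu> n w))"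

definition coeff_b ::
  "(complex \<Rightarrow> complex) \<Rightarrow> (real \<Rightarrow> complex) \<Rightarrow> (nat \<Rightarrow> complex) \<Rightarrow> (nat \<Rightarrow> nat) \<Rightarrow> nat \<Rightarrow> nat \<Rightarrow>
   nat \<Rightarrow> nat \<Rightarrow> nat \<Rightarrow> complex" where
  "coeff_b f \<Gamma>2 pt \<mu> p q n j l = 1 / (2 * of_real pi * \<i>) *
     contour_integral \<Gamma>2 (\<lambda>w.
       node_prod {q+1..p} pt \<mu> n w / node_prod {1..q} pt \<mu> n w * (f w / (w - pt j) ^ (l + 1)))"

definition coeff_c ::
  "(complex \<Rightarrow> complex) \<Rightarrow> (real \<Rightarrow> complex) \<Rightarrow> (nat \<Rightarrow> complex) \<Rightarrow> (nat \<Rightarrow> nat) \<Rightarrow> nat \<Rightarrow> nat \<Rightarrow>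
   nat \<Rightarrow> nat \<Rightarrow> nat \<Rightarrow> complex" where
  "coeff_c f \<Gamma>2 pt \<mu> p q n j l = 1 / (2 * of_real pi * \<i>) *
     contour_integral \<Gamma>2 (\<lambda>w.
       node_prod {q+1..p} pt \<mu> (n + 1) w / node_prod {1..q} pt \<mu> (n + 1) w *
       (f w / (w - pt j) ^ (l + 1)))"

definition q_poly ::
  "(complex \<Rightarrow> complex) \<Rightarrow> (real \<Rightarrow> complex) \<Rightarrow> (nat \<Rightarrow> complex) \<Rightarrow> (nat \<Rightarrow> nat) \<Rightarrow> nat \<Rightarrow> nat \<Rightarrow>
   complex poly" where
  "q_poly f \<Gamma>1 pt \<mu> p n = hermite_poly {1..p} pt \<mu> (coeff_a f \<Gamma>1 pt \<mu> p n)"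

definition t1_poly ::
  "(complex \<Rightarrow> complex) \<Rightarrow> (real \<Rightarrow> complex) \<Rightarrow> (nat \<Rightarrow> complex) \<Rightarrow> (nat \<Rightarrow> nat) \<Rightarrow> nat \<Rightarrow> nat \<Rightarrow>
   nat \<Rightarrow> complex poly" where
  "t1_poly f \<Gamma>2 pt \<mu> p q n = - hermite_poly {1..q} pt \<mu> (coeff_b f \<Gamma>2 pt \<mu> p q n)"

definition t2_poly ::
  "(complex \<Rightarrow> complex) \<Rightarrow> (real \<Rightarrow> complex) \<Rightarrow> (nat \<Rightarrow> complex) \<Rightarrow> (nat \<Rightarrow> nat) \<Rightarrow> nat \<Rightarrow> nat \<Rightarrow>
   nat \<Rightarrow> complex poly" where
  "t2_poly f \<Gamma>2 pt \<mu> p q n = hermite_poly {q+1..p} pt \<mu> (coeff_c f \<Gamma>2 pt \<mu> p q n)"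

definition remainder ::
  "(complex \<Rightarrow> complex) \<Rightarrow> (real \<Rightarrow> complex) \<Rightarrow> (real \<Rightarrow> complex) \<Rightarrow> (nat \<Rightarrow> complex) \<Rightarrow>
   (nat \<Rightarrow> nat) \<Rightarrow> nat \<Rightarrow> nat \<Rightarrow> nat \<Rightarrow> complex \<Rightarrow> complex" where
  "remainder f \<Gamma>1 \<Gamma>2 pt \<mu> p q N z =
     1 / (2 * of_real pi * \<i>) *
       contour_integral \<Gamma>1 (\<lambda>w. f w / ((w - z) * node_prod {1..p} pt \<mu> N w)) *
       node_prod {1..p} pt \<mu> N z
     - 1 / (2 * of_real pi * \<i>) *
       contour_integral \<Gamma>2 (\<lambda>w.
         node_prod {q+1..p} pt \<mu> N w / node_prod {1..q} pt \<mu> N w * (f w / (w - z))) *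
       (node_prod {1..q} pt \<mu> N z / node_prod {q+1..p} pt \<mu> N z)"

text \<open>The infimum of the empty set in \<^typ>\<open>ereal\<close> is \<open>\<infinity>\<close>.\<close>

definition radius1 :: "complex set \<Rightarrow> (nat \<Rightarrow> complex) \<Rightarrow> (nat \<Rightarrow> nat) \<Rightarrow> nat \<Rightarrow> ereal" where
  "radius1 \<Omega> pt \<mu> p = (INF w \<in> - \<Omega>. ereal (node_abs {1..p} pt \<mu> w))"

definition radius2 :: "complex set \<Rightarrow> (nat \<Rightarrow> complex) \<Rightarrow> (nat \<Rightarrow> nat) \<Rightarrow> nat \<Rightarrow> nat \<Rightarrow> ereal" where
  "radius2 \<Omega>0 pt \<mu> p q =
     (INF w \<in> \<Omega>0. if w \<in> pt ` {q+1..p} then \<infinity>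
        else ereal (node_abs {1..q} pt \<mu> w * inverse (node_abs {q+1..p} pt \<mu> w)))"

definition conv_region ::
  "complex set \<Rightarrow> complex set \<Rightarrow> (nat \<Rightarrow> complex) \<Rightarrow> (nat \<Rightarrow> nat) \<Rightarrow> nat \<Rightarrow> nat \<Rightarrow> complex set" where
  "conv_region \<Omega> \<Omega>0 pt \<mu> p q =
     {z \<in> \<Omega> - \<Omega>0.
        ereal (node_abs {1..p} pt \<mu> z) < radius1 \<Omega> pt \<mu> p \<and>
        ereal (node_abs {1..q} pt \<mu> z) <
          radius2 \<Omega>0 pt \<mu> p q * ereal (node_abs {q+1..p} pt \<mu> z)}"

end

(*
  Let V = Omega - Omega0.  For a compact K in V, the boundary of the union of all small grid squares
  meeting K is a finite family of segments in V - K, and f is represented on K by its Cauchy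
  integral over these segments (no closed contours need to be extracted).  Inserting this into an
  integral of f times a rational kernel over a loop in K and exchanging the integrations leaves the
  integral of the kernel against 1/(v - w), which winding numbers evaluate at every point v of the
  segments.  A suitable K does everything: if K contains the closed region between the loops,
  every v lies outside Gamma1 or inside Gamma2, which gives the Cauchy formula for the two loops; if
  K also contains the part of {|P| <= rho} outside Gamma1, where P is the product of the
  (w - z_k)^(m_k), then only points v with |P(v)| > rho > |P(z)| contribute to the first part of the
  remainder, so it decays geometrically, and the second part is handled in the same way with
  K containing the part of a sublevel set of the quotient inside Gamma2.
  The expansion itself telescopes, because the Hermite interpolant at the nodes of z |-> 1/(w - z) is
  (1 - P(z)/P(w))/(w - z).
*)
theory Submission
  imports Defs
begin

subsection \<open>Exchanging contour integrals\<close>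

text \<open>On \<open>\<Gamma>1\<close> itself |P| may fall below |P(z)|, so the remainder cannot be
  estimated along the given loops. Deforming them to level curves of P and of the quotient is
  awkward, since such curves may be disconnected or singular. Moving the integration to segments
  replaces the deformation by a computation of weights. The outer kernel has all its poles (z and
  the nodes) inside \<open>\<Gamma>1\<close>, and together with 1/(v - w) it decays at least like
  |w| to the power -2 at infinity; hence a point v carries the weight 1 minus its winding number,
  which is 0 inside \<open>\<Gamma>1\<close>. The inner kernel has its poles outside
  \<open>\<Gamma>2\<close>, so v carries its winding number as weight (up to sign), which is 0
  outside \<open>\<Gamma>2\<close>. The two radii are what keeps the compact sets inside V: a level
  below r1 keeps the sublevel set of |P| inside \<Omega>, and a level below r2 keeps the sublevel
  set of the quotient away from \<Omega>0. The gap between the value at z and the chosen level is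
  the ratio of the geometric decay.\<close>

lemma Cauchy_transform_linepath_holomorphic:
  assumes "continuous_on (closed_segment a b) f"
  shows "(\<lambda>x. contour_integral (linepath a b) (\<lambda>v. f v / (v - x))) holomorphic_on - closed_segment a b"
proof (rule holomorphic_onI)
  fix x assume x: "x \<in> - closed_segment a b"
  have int: "((\<lambda>v. f v / (v - y) ^ 1) has_contour_integral
      contour_integral (linepath a b) (\<lambda>v. f v / (v - y))) (linepath a b)"
    if "y \<in> UNIV - path_image (linepath a b)" for y
    using that
    by (auto intro!: has_contour_integral_integral contour_integrable_continuous_linepath
        continuous_intros assms)
  have "((\<lambda>x. contour_integral (linepath a b) (\<lambda>v. f v / (v - x))) has_field_derivative
      of_nat 1 * contour_integral (linepath a b) (\<lambda>v. f v / (v - x) ^ Suc 1)) (at x)"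
    \<comment> \<open>Differentiation under the integral sign; \<open>B\<close> bounds the speed of
      the path, which is constant on a segment.\<close>
    by (rule Cauchy_next_derivative[where B = "norm (b - a)" and S = UNIV])
      (use x int assms in auto)
  then show "(\<lambda>x. contour_integral (linepath a b) (\<lambda>v. f v / (v - x)))
      field_differentiable at x within - closed_segment a b"
    using field_differentiable_at_within field_differentiable_def by blast
qed

text \<open>
  The fact \<open>contour_integral_swap\<close> wants continuously differentiable paths, so the loop is first replaced
  by a nearby polynomial path with the same integrals.
\<close>

lemma contour_integral_swap_linepath:
  assumes g: "valid_path \<gamma>" and S: "open S" "path_image \<gamma> \<subseteq> S" and hol: "h holomorphic_on S"
    and f: "continuous_on (closed_segment a b) f" and disj: "closed_segment a b \<inter> path_image \<gamma> = {}"
  shows "contour_integral \<gamma> (\<lambda>w. contour_integral (linepath a b) (\<lambda>v. f v / (v - w)) * h w) =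
    contour_integral (linepath a b) (\<lambda>v. f v * contour_integral \<gamma> (\<lambda>w. h w / (v - w)))"
proof -
  \<comment> \<open>On \<open>U\<close> both the Cauchy transform of the segment and, for each
    \<open>v\<close> on the segment, the kernel \<open>h w / (v - w)\<close> are holomorphic in
    \<open>w\<close>. One approximating path inside \<open>U\<close> therefore serves both sides of
    the identity.\<close>
  define U where "U = S - closed_segment a b"
  have U: "open U" "path_image \<gamma> \<subseteq> U"
    unfolding U_def using S disj by (auto intro!: open_Diff)
  obtain d where d: "d > 0" "\<And>g h. valid_path g \<Longrightarrow> valid_path h \<Longrightarrow>
      (\<forall>t\<in>{0..1}. norm (g t - \<gamma> t) < d \<and> norm (h t - \<gamma> t) < d) \<Longrightarrow>
      pathstart h = pathstart g \<and> pathfinish h = pathfinish g \<Longrightarrow>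
      path_image g \<subseteq> U \<and> path_image h \<subseteq> U \<and>
      (\<forall>f. f holomorphic_on U \<longrightarrow> contour_integral h f = contour_integral g f)"
    using contour_integral_nearby_ends[OF U(1) valid_path_imp_path[OF g] U(2)] by metis
  obtain p where p: "polynomial_function p" "pathstart p = pathstart \<gamma>" "pathfinish p = pathfinish \<gamma>"
    "\<forall>t\<in>{0..1}. norm (p t - \<gamma> t) < d"
    using path_approx_polynomial_function[OF valid_path_imp_path[OF g] d(1)] by metis
  have vp: "valid_path p" using p valid_path_polynomial_function by blast
  have pU: "path_image p \<subseteq> U" and eq: "F holomorphic_on U \<Longrightarrow> contour_integral p F = contour_integral \<gamma> F" for F
    using d(2)[OF g vp] p d(1) by auto
  have holL: "(\<lambda>w. contour_integral (linepath a b) (\<lambda>v. f v / (v - w)) * h w) holomorphic_on U"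
    by (intro holomorphic_intros holomorphic_on_subset[OF Cauchy_transform_linepath_holomorphic[OF f]]
        holomorphic_on_subset[OF hol]) (auto simp: U_def)
  obtain p' where "polynomial_function p'" "\<And>x. (p has_vector_derivative p' x) (at x)"
    using has_vector_derivative_polynomial_function p(1) by metis
  then have vd: "continuous_on {0..1} (\<lambda>t. vector_derivative p (at t))"
    by (metis (no_types, lifting) continuous_on_cong continuous_on_polymonial_function vector_derivative_at)
  have vdl: "continuous_on {0..1} (\<lambda>t. vector_derivative (linepath a b) (at t))"
    by (simp add: continuous_on_const)
  have hp: "continuous_on (path_image p) h"
    using hol pU U_def by (auto intro: holomorphic_on_imp_continuous_on continuous_on_subset)
  have "contour_integral \<gamma> (\<lambda>w. contour_integral (linepath a b) (\<lambda>v. f v / (v - w)) * h w) =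
    contour_integral p (\<lambda>w. contour_integral (linepath a b) (\<lambda>v. f v / (v - w)) * h w)"
    using eq[OF holL] by simp
  also have "\<dots> = contour_integral p (\<lambda>w. contour_integral (linepath a b) (\<lambda>v. f v * h w / (v - w)))"
  proof (rule contour_integral_cong[OF refl])
    fix w assume "w \<in> path_image p"
    then have "w \<notin> closed_segment a b" using pU by (auto simp: U_def)
    then have "(\<lambda>v. f v / (v - w)) contour_integrable_on linepath a b"
      by (auto intro!: contour_integrable_continuous_linepath continuous_intros f)
    then have "contour_integral (linepath a b) (\<lambda>v. f v / (v - w) * h w) =
       contour_integral (linepath a b) (\<lambda>v. f v / (v - w)) * h w"
      by (rule contour_integral_rmul)
    then show "contour_integral (linepath a b) (\<lambda>v. f v / (v - w)) * h w =
       contour_integral (linepath a b) (\<lambda>v. f v * h w / (v - w))"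
      by simp
  qed
  also have "\<dots> = contour_integral (linepath a b) (\<lambda>v. contour_integral p (\<lambda>w. f v * h w / (v - w)))"
  proof (rule contour_integral_swap[OF _ vp _ vd vdl])
    have "continuous_on (path_image p \<times> closed_segment a b) (\<lambda>z. f (snd z))"
      by (intro continuous_on_compose2[OF f] continuous_intros) auto
    moreover have "continuous_on (path_image p \<times> closed_segment a b) (\<lambda>z. h (fst z))"
      by (intro continuous_on_compose2[OF hp] continuous_intros) auto
    ultimately show "continuous_on (path_image p \<times> path_image (linepath a b)) (\<lambda>(w, v). f v * h w / (v - w))"
      using pU by (auto simp: case_prod_unfold U_def intro!: continuous_intros)
  qed auto
  also have "\<dots> = contour_integral (linepath a b) (\<lambda>v. f v * contour_integral \<gamma> (\<lambda>w. h w / (v - w)))"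
  proof (rule contour_integral_cong[OF refl])
    fix v assume "v \<in> path_image (linepath a b)"
    then have v: "v \<in> closed_segment a b" by simp
    have holv: "(\<lambda>w. h w / (v - w)) holomorphic_on U"
      by (intro holomorphic_intros holomorphic_on_subset[OF hol]) (use v in \<open>auto simp: U_def\<close>)
    then have "(\<lambda>w. h w / (v - w)) contour_integrable_on p"
      using contour_integrable_holomorphic_simple U(1) vp pU by blast
    then have "contour_integral p (\<lambda>w. f v * (h w / (v - w))) = f v * contour_integral p (\<lambda>w. h w / (v - w))"
      by (rule contour_integral_lmul)
    then show "contour_integral p (\<lambda>w. f v * h w / (v - w)) = f v * contour_integral \<gamma> (\<lambda>w. h w / (v - w))"
      using eq[OF holv] by simp
  qed
  finally show ?thesis .
qed

subsection \<open>Integrals of reciprocals of polynomials\<close>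

text \<open>Roots are kept in a list, repeated according to multiplicity, so that partial fractions
  become an induction on the number of factors.\<close>

definition prod_diff :: "complex list \<Rightarrow> complex \<Rightarrow> complex" where
  "prod_diff as w = (\<Prod>a\<leftarrow>as. w - a)"

lemma prod_diff_simps [simp]:
  "prod_diff [] w = 1" "prod_diff (a # as) w = (w - a) * prod_diff as w"
  by (auto simp: prod_diff_def)

lemma prod_diff_eq_0_iff: "prod_diff as w = 0 \<longleftrightarrow> w \<in> set as"
  by (induction as) auto

lemma holomorphic_on_prod_diff [holomorphic_intros]: "prod_diff as holomorphic_on S"
proof (induction as)
  case Nil
  have "prod_diff [] = (\<lambda>w. 1)" by auto
  then show ?case by simp
next
  case (Cons a as)
  have "prod_diff (a # as) = (\<lambda>w. (w - a) * prod_diff as w)" by auto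
  then show ?case by (auto intro!: holomorphic_intros Cons)
qed

context
  fixes \<gamma> :: "real \<Rightarrow> complex"
  assumes loop: "valid_path \<gamma>" "pathfinish \<gamma> = pathstart \<gamma>"
begin

lemma inverse_prod_diff_integrable:
  assumes "set as \<inter> path_image \<gamma> = {}"
  shows "(\<lambda>w. 1 / prod_diff as w) contour_integrable_on \<gamma>"
  using assms
  by (intro contour_integrable_holomorphic_simple[where S = "- set as"] holomorphic_intros)
    (auto simp: loop prod_diff_eq_0_iff open_Compl finite_imp_closed)

lemma prod_diff_split:
  assumes "a \<noteq> b" "a \<in> set as" "b \<in> set as"
  obtains bs where "length as = Suc (Suc (length bs))" "set as = insert a (insert b (set bs))"
    "\<And>w. prod_diff as w = (w - a) * ((w - b) * prod_diff bs w)"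
proof
  let ?bs = "remove1 a (remove1 b as)"
  show "length as = Suc (Suc (length ?bs))"
    using assms length_pos_if_in_set[of b as] length_pos_if_in_set[of a "remove1 b as"]
    by (auto simp: length_remove1)
  have "mset as = add_mset b (mset (remove1 b as))"
    using assms(3) by simp
  moreover have "mset (remove1 b as) = add_mset a (mset ?bs)"
    using assms(1,2) by (metis in_set_remove1 insert_DiffM mset_remove1 set_mset_mset)
  ultimately have m: "mset as = add_mset a (add_mset b (mset ?bs))"
    by (simp add: add_mset_commute)
  then show "set as = insert a (insert b (set ?bs))"
    by (metis set_mset_add_mset_insert set_mset_mset)
  have "prod_diff as w = prod_diff (a # b # ?bs) w" for w
    unfolding prod_diff_def using m by (metis mset.simps(2) mset_map prod_mset_prod_list)
  then show "\<And>w. prod_diff as w = (w - a) * ((w - b) * prod_diff ?bs w)" by simp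
qed

text \<open>Integrates 1/((w - a)(w - b)) = (1/(w - a) - 1/(w - b))/(a - b) after multiplication
  with the remaining factors. Each integral on the right has one factor less.\<close>

lemma partial_fraction_step:
  assumes "a \<noteq> b" "insert a (insert b (set bs)) \<inter> path_image \<gamma> = {}"
  shows "contour_integral \<gamma> (\<lambda>w. 1 / ((w - a) * ((w - b) * prod_diff bs w))) =
    (contour_integral \<gamma> (\<lambda>w. 1 / prod_diff (a # bs) w) -
     contour_integral \<gamma> (\<lambda>w. 1 / prod_diff (b # bs) w)) / (a - b)"
proof -
  have "contour_integral \<gamma> (\<lambda>w. 1 / ((w - a) * ((w - b) * prod_diff bs w))) =
    contour_integral \<gamma> (\<lambda>w. (1 / prod_diff (a # bs) w - 1 / prod_diff (b # bs) w) / (a - b))"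
  proof (rule contour_integral_cong[OF refl])
    fix w assume "w \<in> path_image \<gamma>"
    then have "w - a \<noteq> 0" "w - b \<noteq> 0" "prod_diff bs w \<noteq> 0" "a - b \<noteq> 0"
      using assms by (auto simp: prod_diff_eq_0_iff)
    then show "1 / ((w - a) * ((w - b) * prod_diff bs w)) =
      (1 / prod_diff (a # bs) w - 1 / prod_diff (b # bs) w) / (a - b)"
      by (simp add: divide_simps)
  qed
  also have "\<dots> = (contour_integral \<gamma> (\<lambda>w. 1 / prod_diff (a # bs) w) -
     contour_integral \<gamma> (\<lambda>w. 1 / prod_diff (b # bs) w)) / (a - b)"
    using assms
    by (simp add: contour_integral_div contour_integral_diff contour_integrable_diff
        inverse_prod_diff_integrable del: prod_diff_simps)
  finally show ?thesis .
qed

lemma contour_integral_inverse_linear: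
  assumes "a \<notin> path_image \<gamma>"
  shows "contour_integral \<gamma> (\<lambda>w. 1 / (w - a)) = 2 * of_real pi * \<i> * winding_number \<gamma> a"
  using winding_number_valid_path[OF loop(1) assms] by simp

text \<open>With a common winding number the integral is a multiple of the sum of all residues, and
  that sum is 0 because the integrand decays at least like |w| to the power -2. The induction proves
  this without residues: two distinct roots are separated by partial fractions, and a pure power has
  a primitive.\<close>

lemma contour_integral_inverse_prod_diff_0:
  assumes "set as \<inter> path_image \<gamma> = {}" "length as \<ge> 2"
    and "\<And>a. a \<in> set as \<Longrightarrow> winding_number \<gamma> a = c"
  shows "contour_integral \<gamma> (\<lambda>w. 1 / prod_diff as w) = 0"
  using assms
proof (induction "length as" arbitrary: as rule: less_induct)
  case less
  show ?case
  proof (cases "\<exists>a b. a \<noteq> b \<and> a \<in> set as \<and> b \<in> set as")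
    case True
    then obtain a b where ab: "a \<noteq> b" "a \<in> set as" "b \<in> set as" by blast
    from prod_diff_split[OF this] obtain bs where bs: "length as = Suc (Suc (length bs))"
      "set as = insert a (insert b (set bs))"
      "\<And>w. prod_diff as w = (w - a) * ((w - b) * prod_diff bs w)" by metis
    \<comment> \<open>If only \<open>a\<close> and \<open>b\<close> are left, both integrals equal
      the same multiple of \<open>c\<close>; otherwise both vanish by induction.\<close>
    have "contour_integral \<gamma> (\<lambda>w. 1 / prod_diff (a # bs) w) =
      contour_integral \<gamma> (\<lambda>w. 1 / prod_diff (b # bs) w)"
    proof (cases bs)
      case Nil
      then show ?thesis
        using less.prems ab
        by (simp add: contour_integral_inverse_linear disjoint_iff)
    next
      case (Cons x xs)
      have "contour_integral \<gamma> (\<lambda>w. 1 / prod_diff (a # bs) w) = 0"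
        by (rule less.hyps) (use less.prems bs Cons in auto)
      moreover have "contour_integral \<gamma> (\<lambda>w. 1 / prod_diff (b # bs) w) = 0"
        by (rule less.hyps) (use less.prems bs Cons in auto)
      ultimately show ?thesis by simp
    qed
    then show ?thesis
      using partial_fraction_step[OF ab(1), of bs] bs less.prems by simp
  next
    case False
    obtain a n where as: "as = replicate (Suc (Suc n)) a"
    proof -
      obtain a n where "length as = Suc (Suc n)" "a \<in> set as"
        using less.prems(2) by (cases as; cases "tl as") auto
      moreover then have "as = replicate (length as) a"
        using False by (intro replicate_eqI) auto
      ultimately show ?thesis using that by metis
    qed
    have rep: "prod_diff (replicate k a) w = (w - a) ^ k" for k w
      by (induction k) auto
    \<comment> \<open>All roots coincide, and there are n + 2 of them, so the primitive has exponent
      n + 1, which is never 0.\<close>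
    have "((\<lambda>w. 1 / prod_diff as w) has_contour_integral 0) \<gamma>"
    proof (rule Cauchy_theorem_primitive[where f = "\<lambda>w. - 1 / (of_nat (Suc n) * (w - a) ^ Suc n)"
          and S = "path_image \<gamma>"])
      fix w assume "w \<in> path_image \<gamma>"
      then have "w - a \<noteq> 0" using less.prems(1) as by auto
      then show "((\<lambda>w. - 1 / (of_nat (Suc n) * (w - a) ^ Suc n)) has_field_derivative
         1 / prod_diff as w) (at w within path_image \<gamma>)"
        unfolding as rep
        by (auto intro!: derivative_eq_intros simp del: of_nat_Suc)
          (cases n; simp add: divide_simps del: of_nat_Suc; simp add: algebra_simps)
    qed (use loop in auto)
    then show ?thesis by (rule contour_integral_unique)
  qed
qed

text \<open>The residues at the roots add up to minus the residue at \<open>v\<close>. The roots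
  carry the weight \<open>c\<close> and \<open>v\<close> carries its own winding number, so only the
  difference of the two remains. Its sign comes from 1/(v - w) instead of 1/(w - v).\<close>

lemma contour_integral_inverse_prod_diff:
  assumes "set as \<inter> path_image \<gamma> = {}" "as \<noteq> []" "v \<notin> path_image \<gamma>"
    and "\<And>a. a \<in> set as \<Longrightarrow> winding_number \<gamma> a = c"
  shows "contour_integral \<gamma> (\<lambda>w. 1 / prod_diff as w / (v - w)) =
    2 * of_real pi * \<i> * (c - winding_number \<gamma> v) / prod_diff as v"
proof -
  have eq: "1 / prod_diff as w / (v - w) = - (1 / ((w - v) * prod_diff as w))" for w
    by (metis divide_divide_eq_left minus_diff_eq minus_divide_right mult.commute)
  show ?thesis
  proof (cases "winding_number \<gamma> v = c")
    \<comment> \<open>Here \<open>v\<close> may itself be one of the roots; both sides are then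
      still 0, the right one because its numerator vanishes.\<close>
    case True
    have "contour_integral \<gamma> (\<lambda>w. 1 / prod_diff as w / (v - w)) =
      contour_integral \<gamma> (\<lambda>w. - (1 / prod_diff (v # as) w))"
      by (rule contour_integral_cong) (simp_all only: eq prod_diff_simps)
    also have "\<dots> = - contour_integral \<gamma> (\<lambda>w. 1 / prod_diff (v # as) w)"
      by (rule contour_integral_neg)
    also have "contour_integral \<gamma> (\<lambda>w. 1 / prod_diff (v # as) w) = 0"
      by (rule contour_integral_inverse_prod_diff_0[where c = c]) (use assms True in \<open>auto simp: Suc_le_eq\<close>)
    finally show ?thesis using True by simp
  next
    case False
    have "contour_integral \<gamma> (\<lambda>w. 1 / prod_diff (v # as) w) =
      2 * of_real pi * \<i> * (winding_number \<gamma> v - c) / prod_diff as v"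
      using assms
    proof (induction as)
      case (Cons a as)
      \<comment> \<open>Different winding numbers force \<open>v\<close> and \<open>a\<close> apart,
        which is what the partial fractions need.\<close>
      have va: "v \<noteq> a" using Cons.prems False by auto
      have "contour_integral \<gamma> (\<lambda>w. 1 / prod_diff (v # a # as) w) =
       (contour_integral \<gamma> (\<lambda>w. 1 / prod_diff (v # as) w) -
       contour_integral \<gamma> (\<lambda>w. 1 / prod_diff (a # as) w)) / (v - a)"
        using partial_fraction_step[OF va, of as] Cons.prems by auto
      also have "\<dots> = 2 * of_real pi * \<i> * (winding_number \<gamma> v - c) / prod_diff (a # as) v"
      proof (cases "as = []")
        case True
        then show ?thesis
          using Cons.prems by (auto simp: contour_integral_inverse_linear algebra_simps)
      next
        case False
        have "contour_integral \<gamma> (\<lambda>w. 1 / prod_diff (a # as) w) = 0"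
          by (rule contour_integral_inverse_prod_diff_0[where c = c])
            (use Cons.prems False in \<open>auto simp: Suc_le_eq\<close>)
        then show ?thesis using Cons False by auto
      qed
      finally show ?case .
    qed auto
    moreover have "contour_integral \<gamma> (\<lambda>w. 1 / prod_diff as w / (v - w)) =
      contour_integral \<gamma> (\<lambda>w. - (1 / prod_diff (v # as) w))"
      by (rule contour_integral_cong) (simp_all only: eq prod_diff_simps)
    ultimately show ?thesis
      using contour_integral_neg[of \<gamma> "\<lambda>w. 1 / prod_diff (v # as) w"]
      by (simp add: algebra_simps diff_divide_distrib del: prod_diff_simps)
  qed
qed

end

subsection \<open>The Cauchy formula on a compact set\<close>

text \<open>The segments depend on \<open>K\<close> and \<open>V\<close> only, so one family
  represents every function holomorphic on \<open>V\<close>. The formula is the sum of the Cauchy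
  formulas over the squares meeting \<open>K\<close>; an edge shared by two such squares is
  traversed in both directions and drops out.\<close>

lemma Cauchy_formula_segments:
  assumes K: "compact K" and V: "open V" "K \<subseteq> V"
  obtains n :: nat and a b :: "nat \<Rightarrow> complex"
  where "\<And>i. i < n \<Longrightarrow> closed_segment (a i) (b i) \<subseteq> V - K"
    and "\<And>f x. f holomorphic_on V \<Longrightarrow> x \<in> K \<Longrightarrow>
      2 * of_real pi * \<i> * f x = (\<Sum>i<n. contour_integral (linepath (a i) (b i)) (\<lambda>v. f v / (v - x)))"
proof -
  obtain d where d: "d > 0" "\<And>x. x \<in> K \<Longrightarrow> ball x d \<subseteq> V"
    using compact_subset_open_imp_ball_epsilon_subset[OF K V] by (metis UN_subset_iff)
  \<comment> \<open>Two points of a closed square with side d/3 are at distance at most 2d/3 < d, so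
    every square meeting \<open>K\<close> stays in \<open>V\<close>.\<close>
  define \<delta> where "\<delta> = d / 3"
  have \<delta>: "\<delta> > 0" using d by (simp add: \<delta>_def)
  define g where "g = (\<lambda>i j :: int. Complex (\<delta> * of_int i) (\<delta> * of_int j))"
  define Q where "Q = (\<lambda>(i, j). cbox (g i j) (g (i + 1) (j + 1)))"
  define B where "B = (\<lambda>(i, j). box (g i j) (g (i + 1) (j + 1)))"
  define I where "I = {s. Q s \<inter> K \<noteq> {}}"
  \<comment> \<open>Squares are indexed by their lower left corner, and only bottom edges
    \<open>hor\<close> and left edges \<open>ver\<close> get a name. The top edge of
    \<open>s\<close> is \<open>hor (up s)\<close> and its right edge is \<open>ver (rt s)\<close>,
    so the cancellation of shared edges becomes a reindexing of sums.\<close>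
  define up where "up = (\<lambda>(i :: int, j). (i, j + 1 :: int))"
  define rt where "rt = (\<lambda>(i, j :: int). (i + 1 :: int, j))"
  define hor where "hor = (\<lambda>(i, j). (g i j, g (i + 1) j))"
  define ver where "ver = (\<lambda>(i, j). (g i j, g i (j + 1)))"
  have inQ: "x \<in> Q (i, j) \<longleftrightarrow> \<delta> * of_int i \<le> Re x \<and> Re x \<le> \<delta> * of_int (i + 1) \<and>
      \<delta> * of_int j \<le> Im x \<and> Im x \<le> \<delta> * of_int (j + 1)" for x i j
    by (auto simp: Q_def g_def in_cbox_complex_iff)
  have inB: "x \<in> B (i, j) \<longleftrightarrow> \<delta> * of_int i < Re x \<and> Re x < \<delta> * of_int (i + 1) \<and>
      \<delta> * of_int j < Im x \<and> Im x < \<delta> * of_int (j + 1)" for x i j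
    by (auto simp: B_def g_def in_box_complex_iff)
  have QV: "Q s \<subseteq> V" if sI: "s \<in> I" for s
  proof
    fix y assume y: "y \<in> Q s"
    obtain i j where s: "s = (i, j)" by (cases s)
    obtain x where x: "x \<in> K" "x \<in> Q s" using sI by (auto simp: I_def)
    have "\<bar>Re (x - y)\<bar> \<le> \<delta>" "\<bar>Im (x - y)\<bar> \<le> \<delta>"
      using x(2) y unfolding s inQ by (auto simp: algebra_simps)
    then have "dist x y < d"
      using cmod_le[of "x - y"] d(1) by (simp add: dist_norm \<delta>_def)
    then show "y \<in> V" using d(2)[OF x(1)] by auto
  qed
  have fin: "finite I"
  proof -
    obtain R where R: "\<And>x. x \<in> K \<Longrightarrow> norm x \<le> R"
      using compact_imp_bounded[OF K] by (auto simp: bounded_iff)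
    \<comment> \<open>The additional 1 pays for the lower bound: a point of the square with index
      \<open>i\<close> only yields \<open>i + 1\<close> at least minus the ceiling.\<close>
    define M where "M = \<lceil>R / \<delta>\<rceil> + 1"
    have "I \<subseteq> {-M..M} \<times> {-M..M}"
    proof
      fix s assume s: "s \<in> I"
      obtain i j where ij: "s = (i, j)" by (cases s)
      obtain x where x: "x \<in> K" "x \<in> Q (i, j)" using s ij by (auto simp: I_def)
      have M: "R \<le> \<delta> * of_int (M - 1)"
        using \<delta> by (simp add: M_def field_simps) (metis le_of_int_ceiling mult.commute pos_divide_le_eq)
      have "\<bar>Re x\<bar> \<le> R" "\<bar>Im x\<bar> \<le> R"
        using R[OF x(1)] abs_Re_le_cmod[of x] abs_Im_le_cmod[of x] by auto
      then have "\<delta> * of_int i \<le> \<delta> * of_int (M - 1)" "\<delta> * of_int j \<le> \<delta> * of_int (M - 1)"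
         "\<delta> * of_int (- (M - 1)) \<le> \<delta> * of_int (i + 1)" "\<delta> * of_int (- (M - 1)) \<le> \<delta> * of_int (j + 1)"
        using x(2) M unfolding inQ by (auto simp: algebra_simps)
      then have "i \<le> M - 1" "j \<le> M - 1" "- (M - 1) \<le> i + 1" "- (M - 1) \<le> j + 1"
        using \<delta> by (simp_all only: mult_le_cancel_left_pos of_int_le_iff)
      then show "s \<in> {-M..M} \<times> {-M..M}" using ij by auto
    qed
    then show ?thesis by (rule finite_subset) auto
  qed
  have cover: "\<exists>s\<in>I. x \<in> Q s" if "x \<in> K" for x
  proof -
    have "x \<in> Q (\<lfloor>Re x / \<delta>\<rfloor>, \<lfloor>Im x / \<delta>\<rfloor>)"
      unfolding inQ
      using \<delta> floor_divide_lower[of \<delta> "Re x"] floor_divide_upper[of \<delta> "Re x"]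
        floor_divide_lower[of \<delta> "Im x"] floor_divide_upper[of \<delta> "Im x"]
      by (simp add: algebra_simps)
    then show ?thesis using that by (auto simp: I_def)
  qed
  have disjQ: "s = t" if "x \<in> B s" "x \<in> Q t" for x s t
  proof -
    obtain i j k l where st: "s = (i, j)" "t = (k, l)" by (cases s; cases t)
    have "\<delta> * of_int i < \<delta> * of_int (k + 1)" "\<delta> * of_int k < \<delta> * of_int (i + 1)"
      "\<delta> * of_int j < \<delta> * of_int (l + 1)" "\<delta> * of_int l < \<delta> * of_int (j + 1)"
      using that unfolding st inQ inB by linarith+
    then have "i < k + 1" "k < i + 1" "j < l + 1" "l < j + 1"
      using \<delta> by (simp_all only: mult_less_cancel_left_pos of_int_less_iff)
    then show ?thesis using st by auto
  qed
  have seg_hor: "x \<in> closed_segment (g i j) (g (i + 1) j) \<longleftrightarrow>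
     Im x = \<delta> * of_int j \<and> \<delta> * of_int i \<le> Re x \<and> Re x \<le> \<delta> * of_int (i + 1)" for x i j
    using \<delta> by (auto simp: g_def closed_segment_same_Im closed_segment_eq_real_ivl)
  have seg_ver: "x \<in> closed_segment (g i j) (g i (j + 1)) \<longleftrightarrow>
     Re x = \<delta> * of_int i \<and> \<delta> * of_int j \<le> Im x \<and> Im x \<le> \<delta> * of_int (j + 1)" for x i j
    using \<delta> by (auto simp: g_def closed_segment_same_Re closed_segment_eq_real_ivl)
  define seg where "seg = (\<lambda>e :: complex \<times> complex. closed_segment (fst e) (snd e))"
  have horQ: "seg (hor s) \<subseteq> Q s" "seg (hor (up s)) \<subseteq> Q s"
    and verQ: "seg (ver s) \<subseteq> Q s" "seg (ver (rt s)) \<subseteq> Q s"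
    for s
    using \<delta> by (cases s; auto simp: seg_def hor_def ver_def up_def rt_def seg_hor seg_ver inQ)+
  define L where "L = (\<lambda>f x e. contour_integral (linepath (fst e) (snd e)) (\<lambda>v. f v / (v - x)))"
  \<comment> \<open>In the counterclockwise boundary of a square the bottom and right edges count
    positively, the top and left ones negatively. A point of an open square lies on no edge and in
    no other closed square, so Cauchy's formula applies to its own square and Cauchy's theorem to
    the rest.\<close>
  have boundary: "2 * of_real pi * \<i> * f x =
      (\<Sum>s\<in>I. L f x (hor s)) - (\<Sum>s\<in>I. L f x (hor (up s))) +
      ((\<Sum>s\<in>I. L f x (ver (rt s))) - (\<Sum>s\<in>I. L f x (ver s)))"
    if f: "f holomorphic_on V" and t: "t \<in> I" "x \<in> B t" for f x t
  proof -
    have one: "L f x (hor s) - L f x (hor (up s)) + (L f x (ver (rt s)) - L f x (ver s)) =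
      (if s = t then 2 * of_real pi * \<i> * f x else 0)" if s: "s \<in> I" for s
    proof -
      obtain i j where ij: "s = (i, j)" by (cases s)
      have le: "Re (g i j) \<le> Re (g (i + 1) (j + 1))" "Im (g i j) \<le> Im (g (i + 1) (j + 1))"
        using \<delta> by (auto simp: g_def)
      have xn: "x \<notin> Q s - B s"
        using disjQ[OF t(2), of s] t(2) by auto
      have img: "path_image (rectpath (g i j) (g (i + 1) (j + 1))) = Q s - B s"
        using path_image_rectpath_cbox_minus_box[OF le] by (simp add: ij Q_def B_def)
      have hc: "continuous_on V f" using f holomorphic_on_imp_continuous_on by blast
      have cont: "continuous_on (closed_segment a b) (\<lambda>v. f v / (v - x))"
        if "closed_segment a b \<subseteq> Q s - B s" for a b
        using that xn QV[OF s] by (intro continuous_intros continuous_on_subset[OF hc]) auto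
      then have int: "(\<lambda>v. f v / (v - x)) contour_integrable_on linepath a b"
        if "closed_segment a b \<subseteq> Q s - B s" for a b
        using that by (intro contour_integrable_continuous_linepath)
      have sides: "closed_segment (g i j) (g (i + 1) j) \<subseteq> Q s - B s"
        "closed_segment (g (i + 1) j) (g (i + 1) (j + 1)) \<subseteq> Q s - B s"
        "closed_segment (g (i + 1) (j + 1)) (g i (j + 1)) \<subseteq> Q s - B s"
        "closed_segment (g i (j + 1)) (g i j) \<subseteq> Q s - B s"
        unfolding closed_segment_commute[of "g (i + 1) (j + 1)"] closed_segment_commute[of _ "g i j"]
        using \<delta> by (auto simp: ij seg_hor seg_ver inQ inB)
      have "contour_integral (rectpath (g i j) (g (i + 1) (j + 1))) (\<lambda>v. f v / (v - x)) =
        contour_integral (linepath (g i j) (g (i + 1) j)) (\<lambda>v. f v / (v - x)) +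
        (contour_integral (linepath (g (i + 1) j) (g (i + 1) (j + 1))) (\<lambda>v. f v / (v - x)) +
        (contour_integral (linepath (g (i + 1) (j + 1)) (g i (j + 1))) (\<lambda>v. f v / (v - x)) +
        contour_integral (linepath (g i (j + 1)) (g i j)) (\<lambda>v. f v / (v - x))))"
        using int sides
        by (simp add: rectpath_def Let_def g_def contour_integrable_join valid_path_join)
      also have "\<dots> = L f x (hor s) - L f x (hor (up s)) + (L f x (ver (rt s)) - L f x (ver s))"
        using contour_integral_reverse_linepath[OF cont[OF sides(3)]]
          contour_integral_reverse_linepath[OF cont[OF sides(4)]]
        by (simp add: L_def hor_def ver_def up_def rt_def ij)
      finally have eq: "L f x (hor s) - L f x (hor (up s)) + (L f x (ver (rt s)) - L f x (ver s)) =
        contour_integral (rectpath (g i j) (g (i + 1) (j + 1))) (\<lambda>v. f v / (v - x))" by simp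
      have cQ: "convex (Q s)" by (simp add: ij Q_def)
      have fQ: "f holomorphic_on Q s" using f QV[OF s] holomorphic_on_subset by blast
      show ?thesis
      proof (cases "s = t")
        case True
        have xB: "x \<in> box (g i j) (g (i + 1) (j + 1))" using t(2) unfolding True[symmetric] ij by (simp add: B_def)
        have "((\<lambda>v. f v / (v - x)) has_contour_integral (2 * pi * \<i> *
            winding_number (rectpath (g i j) (g (i + 1) (j + 1))) x * f x))
            (rectpath (g i j) (g (i + 1) (j + 1)))"
          by (rule Cauchy_integral_formula_convex_simple[OF cQ fQ])
            (use xB img xn in \<open>auto simp: ij Q_def interior_cbox\<close>)
        moreover have "winding_number (rectpath (g i j) (g (i + 1) (j + 1))) x = 1"
          using xB by (rule winding_number_rectpath)
        ultimately show ?thesis using True eq by (auto dest: contour_integral_unique)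
      next
        case False
        then have "x \<notin> Q s" using disjQ t(2) by blast
        then have "(\<lambda>v. f v / (v - x)) holomorphic_on Q s"
          by (intro holomorphic_intros fQ) auto
        then have "((\<lambda>v. f v / (v - x)) has_contour_integral 0) (rectpath (g i j) (g (i + 1) (j + 1)))"
          by (rule Cauchy_theorem_convex_simple[OF _ cQ]) (use img in auto)
        then show ?thesis using False eq by (auto dest: contour_integral_unique)
      qed
    qed
    have "(\<Sum>s\<in>I. L f x (hor s) - L f x (hor (up s)) + (L f x (ver (rt s)) - L f x (ver s))) =
      2 * of_real pi * \<i> * f x"
      using one fin t(1) by simp
    then show ?thesis by (simp add: sum.distrib sum_subtractf)
  qed
  have inj_up: "inj up" and inj_rt: "inj rt" by (auto simp: inj_def up_def rt_def)
  \<comment> \<open>An edge survives the cancellation iff exactly one of its two squares meets \<open>K\<close>.\<close>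
  have horE: "seg (hor s) \<subseteq> V - K" if s: "s \<in> I - up ` I \<or> s \<in> up ` I - I" for s
  proof -
    obtain s' where s': "s = up s'"
      by (cases s) (auto simp: up_def intro: that[of "(fst s, snd s - 1)"])
    have "s \<in> up ` I \<longleftrightarrow> s' \<in> I" unfolding s' by (rule inj_image_mem_iff[OF inj_up])
    then consider "s \<in> I" "s' \<notin> I" | "s' \<in> I" "s \<notin> I" using s by auto
    then show ?thesis
    proof cases
      case 1
      then show ?thesis using horQ(1)[of s] horQ(2)[of s'] QV[of s] s' by (auto simp: I_def)
    next
      case 2
      then show ?thesis using horQ(1)[of s] horQ(2)[of s'] QV[of s'] s' by (auto simp: I_def)
    qed
  qed
  have verE: "seg (ver s) \<subseteq> V - K" if s: "s \<in> I - rt ` I \<or> s \<in> rt ` I - I" for s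
  proof -
    obtain s' where s': "s = rt s'"
      by (cases s) (auto simp: rt_def intro: that[of "(fst s - 1, snd s)"])
    have "s \<in> rt ` I \<longleftrightarrow> s' \<in> I" unfolding s' by (rule inj_image_mem_iff[OF inj_rt])
    then consider "s \<in> I" "s' \<notin> I" | "s' \<in> I" "s \<notin> I" using s by auto
    then show ?thesis
    proof cases
      case 1
      then show ?thesis using verQ(1)[of s] verQ(2)[of s'] QV[of s] s' by (auto simp: I_def)
    next
      case 2
      then show ?thesis using verQ(1)[of s] verQ(2)[of s'] QV[of s'] s' by (auto simp: I_def)
    qed
  qed
  have cancel: "(\<Sum>s\<in>I. F s) - (\<Sum>s\<in>I. F (\<sigma> s)) = (\<Sum>s\<in>I - \<sigma> ` I. F s) - (\<Sum>s\<in>\<sigma> ` I - I. F s)"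
    if "inj \<sigma>" for F :: "int \<times> int \<Rightarrow> complex" and \<sigma>
  proof -
    have "(\<Sum>s\<in>I. F (\<sigma> s)) = (\<Sum>s\<in>\<sigma> ` I. F s)"
      using that by (subst sum.reindex) (auto intro: inj_on_subset)
    moreover have "(\<Sum>s\<in>I. F s) = (\<Sum>s\<in>I - \<sigma> ` I. F s) + (\<Sum>s\<in>I \<inter> \<sigma> ` I. F s)"
      using fin by (subst sum.union_disjoint[symmetric]) (auto intro: sum.cong)
    moreover have "(\<Sum>s\<in>\<sigma> ` I. F s) = (\<Sum>s\<in>\<sigma> ` I - I. F s) + (\<Sum>s\<in>I \<inter> \<sigma> ` I. F s)"
      using fin by (subst sum.union_disjoint[symmetric]) (auto intro: sum.cong)
    ultimately show ?thesis by simp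
  qed
  define list_of where "list_of = (\<lambda>A :: (int \<times> int) set. SOME xs. set xs = A \<and> distinct xs)"
  have list_of: "set (list_of A) = A" "distinct (list_of A)" if "finite A" for A
    using someI_ex[OF finite_distinct_list[OF that]] by (auto simp: list_of_def)
  \<comment> \<open>The signs of the surviving edges are absorbed by swapping endpoints: top and
    left edges are listed reversed.\<close>
  define es where "es = map hor (list_of (I - up ` I)) @ map (prod.swap \<circ> hor) (list_of (up ` I - I)) @
    map ver (list_of (rt ` I - I)) @ map (prod.swap \<circ> ver) (list_of (I - rt ` I))"
  have es: "seg e \<subseteq> V - K" if "e \<in> set es" for e
  proof -
    have swap: "seg (prod.swap e) = seg e" for e by (simp add: seg_def closed_segment_commute)
    have "(\<exists>s. (s \<in> I - up ` I \<or> s \<in> up ` I - I) \<and> (e = hor s \<or> e = prod.swap (hor s))) \<or>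
        (\<exists>s. (s \<in> I - rt ` I \<or> s \<in> rt ` I - I) \<and> (e = ver s \<or> e = prod.swap (ver s)))"
      using that fin unfolding es_def
      by (simp only: set_append set_map Un_iff image_iff list_of finite_Diff finite_imageI o_apply) blast
    then show ?thesis
      using horE verE swap by metis
  qed
  have Lcont: "continuous_on (seg e) (\<lambda>v. f v / (v - x))"
    if "f holomorphic_on V" "seg e \<subseteq> V - {x}" for f x e
    using that by (intro continuous_intros holomorphic_on_imp_continuous_on[OF holomorphic_on_subset]) auto
  have sum_es: "(\<Sum>e\<leftarrow>es. L f x e) =
      (\<Sum>s\<in>I. L f x (hor s)) - (\<Sum>s\<in>I. L f x (hor (up s))) +
      ((\<Sum>s\<in>I. L f x (ver (rt s))) - (\<Sum>s\<in>I. L f x (ver s)))"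
    if f: "f holomorphic_on V" and x: "\<And>e. e \<in> set es \<Longrightarrow> x \<notin> seg e" for f x
  proof -
    have swap: "L f x (prod.swap e) = - L f x e" if "prod.swap e \<in> set es" for e
    proof -
      have "seg (prod.swap e) = seg e" by (simp add: seg_def closed_segment_commute)
      then have "continuous_on (seg e) (\<lambda>v. f v / (v - x))"
        using es[OF that] x[OF that] by (intro Lcont f) auto
      then show ?thesis
        using contour_integral_reverse_linepath[of "fst e" "snd e" "\<lambda>v. f v / (v - x)"]
        by (simp add: L_def seg_def)
    qed
    have *: "(\<Sum>s\<leftarrow>list_of A. F s) = (\<Sum>s\<in>A. F s)" if "finite A" for A and F :: "_ \<Rightarrow> complex"
      using sum_list_distinct_conv_sum_set[of "list_of A" F] list_of[OF that] by simp
    have h: "(\<Sum>s\<in>up ` I - I. L f x (prod.swap (hor s))) = - (\<Sum>s\<in>up ` I - I. L f x (hor s))"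
      unfolding sum_negf[symmetric] by (intro sum.cong refl swap) (auto simp: es_def list_of fin)
    have v: "(\<Sum>s\<in>I - rt ` I. L f x (prod.swap (ver s))) = - (\<Sum>s\<in>I - rt ` I. L f x (ver s))"
      unfolding sum_negf[symmetric] by (intro sum.cong refl swap) (auto simp: es_def list_of fin)
    show ?thesis
      using cancel[OF inj_up, of "\<lambda>s. L f x (hor s)"]
        arg_cong[OF cancel[OF inj_rt, of "\<lambda>s. L f x (ver s)"], of uminus] fin
      by (simp add: es_def * h v o_def)
  qed
  \<comment> \<open>Points of \<open>K\<close> may lie on the grid lines; the formula extends to them by continuity.\<close>
  have main: "2 * of_real pi * \<i> * f x = (\<Sum>e\<leftarrow>es. L f x e)"
    if f: "f holomorphic_on V" and x: "x \<in> K" for f x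
  proof -
    define W where "W = V - (\<Union>e\<in>set es. seg e)"
    define D where "D = (\<lambda>y. 2 * of_real pi * \<i> * f y - (\<Sum>e\<leftarrow>es. L f y e))"
    have W: "open W"
      unfolding W_def using V by (intro open_Diff closed_UN) (auto simp: seg_def)
    have xW: "x \<in> W" using x V es by (auto simp: W_def)
    obtain r where r: "r > 0" "cball x r \<subseteq> W" using W xW open_contains_cball by blast
    obtain t where t: "t \<in> I" "x \<in> Q t" using cover[OF x] by blast
    \<comment> \<open>\<open>D\<close> vanishes on \<open>A\<close> because \<open>A\<close> lies in
      an open square. The closed square \<open>Q t\<close> is the closure of \<open>B t\<close>, so
      \<open>x\<close> lies in the closure of \<open>A\<close>, where \<open>D\<close> is
      continuous.\<close>
    define A where "A = ball x r \<inter> B t"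
    have AW: "closure A \<subseteq> W"
    proof -
      have "closure A \<subseteq> closure (ball x r)" unfolding A_def by (intro closure_mono) auto
      then show ?thesis using r by auto
    qed
    have "B t \<noteq> {}" using \<delta> by (cases t) (auto simp: B_def g_def box_ne_empty Basis_complex_def)
    then have "closure (B t) = Q t"
      by (cases t) (auto simp: B_def Q_def intro!: closure_box)
    then have xA: "x \<in> closure A"
      using open_Int_closure_subset[of "ball x r" "B t"] t(2) r(1) by (auto simp: A_def)
    have contL: "continuous_on W (\<lambda>y. L f y e)" if "e \<in> set es" for e
    proof -
      have "continuous_on (seg e) f"
        using f es[OF that] by (intro holomorphic_on_imp_continuous_on[OF holomorphic_on_subset]) auto
      then have "(\<lambda>y. L f y e) holomorphic_on - seg e"
        unfolding L_def seg_def by (rule Cauchy_transform_linepath_holomorphic)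
      then show ?thesis
        using that by (intro holomorphic_on_imp_continuous_on[OF holomorphic_on_subset]) (auto simp: W_def)
    qed
    have "continuous_on W (\<lambda>y. \<Sum>e\<leftarrow>es'. L f y e)" if "set es' \<subseteq> set es" for es'
      using that by (induction es') (auto intro!: continuous_intros contL)
    moreover have "continuous_on W f"
      using f by (intro holomorphic_on_imp_continuous_on[OF holomorphic_on_subset]) (auto simp: W_def)
    ultimately have "continuous_on W D"
      unfolding D_def by (intro continuous_intros) auto
    then have "continuous_on (closure A) D"
      using AW continuous_on_subset by blast
    moreover have "D y = 0" if y: "y \<in> A" for y
    proof -
      have "y \<in> W" using y AW closure_subset by blast
      then have "(\<Sum>e\<leftarrow>es. L f y e) =
        (\<Sum>s\<in>I. L f y (hor s)) - (\<Sum>s\<in>I. L f y (hor (up s))) +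
        ((\<Sum>s\<in>I. L f y (ver (rt s))) - (\<Sum>s\<in>I. L f y (ver s)))"
        by (intro sum_es f) (auto simp: W_def)
      then show ?thesis
        using boundary[OF f t(1), of y] y by (simp add: D_def A_def)
    qed
    ultimately have "D x = 0"
      using xA continuous_constant_on_closure by blast
    then show ?thesis by (simp add: D_def)
  qed
  show ?thesis
  proof (rule that)
    show "closed_segment (fst (es ! i)) (snd (es ! i)) \<subseteq> V - K" if "i < length es" for i
      using es[of "es ! i"] that by (simp add: seg_def)
    show "2 * of_real pi * \<i> * f x =
      (\<Sum>i<length es. contour_integral (linepath (fst (es ! i)) (snd (es ! i))) (\<lambda>v. f v / (v - x)))"
      if "f holomorphic_on V" "x \<in> K" for f x
      using main[OF that] by (simp add: sum_list_sum_nth L_def atLeast0LessThan)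
  qed
qed

subsection \<open>Hermite interpolation\<close>

lemma pcompose_power: "pcompose (p ^ n) q = pcompose p q ^ n"
  by (induction n) (auto simp: pcompose_mult pcompose_1)

lemma smult_sum_right: "smult a (\<Sum>i\<in>A. p i) = (\<Sum>i\<in>A. smult a (p i))"
  by (induction A rule: infinite_finite_induct) (auto simp: smult_add_right)

text \<open>The sum is the Taylor polynomial at \<open>pt j\<close> of the reciprocal of the
  cofactor, so the product is 1 up to terms of order \<open>n\<close>. After a translation of
  \<open>pt j\<close> to 0 the divisibility says that the coefficients below \<open>n\<close>
  vanish; these are read off from the identity \<open>fps_of_poly C' * R = 1\<close> of formal power
  series, into which the truncation \<open>T\<close> agrees with \<open>R\<close> far
  enough.\<close>

lemma cofactor_recip_coeff_dvd:
  assumes "finite K" "inj_on pt K" "j \<in> K"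
  shows "[:- pt j, 1:] ^ n dvd
    cofactor K pt \<mu> j * (\<Sum>i<n. smult (recip_coeff K pt \<mu> j i) ([:- pt j, 1:] ^ i)) - 1"
proof -
  define a where "a = pt j"
  define C where "C = cofactor K pt \<mu> j"
  define C' where "C' = pcompose C [:a, 1:]"
  define T where "T = (\<Sum>i<n. monom (recip_coeff K pt \<mu> j i) i)"
  define R where "R = fps_expansion (\<lambda>w. 1 / poly C w) a"
  have C0: "poly C a \<noteq> 0"
    using assms by (auto simp: C_def a_def cofactor_def poly_prod inj_on_def)
  have "poly C holomorphic_on UNIV"
    by (auto simp: holomorphic_on_def intro: field_differentiable_at_within poly_DERIV
        simp: field_differentiable_def)
  then have "poly C analytic_on {a}"
    by (rule holomorphic_on_imp_analytic_at) auto
  then have "(\<lambda>w. 1 / poly C w) analytic_on {a}"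
    by (intro analytic_intros) (use C0 in auto)
  then have R: "(\<lambda>x. 1 / poly C (a + x)) has_fps_expansion R"
    unfolding R_def by (rule analytic_at_imp_has_fps_expansion)
  have "(\<lambda>x. poly C' x) has_fps_expansion fps_of_poly C'"
    by (auto simp: has_fps_expansion_def)
  then have "(\<lambda>x. poly C' x * (1 / poly C (a + x))) has_fps_expansion fps_of_poly C' * R"
    by (intro has_fps_expansion_mult R)
  moreover have "eventually (\<lambda>x. poly C' x * (1 / poly C (a + x)) = 1) (nhds 0)"
  proof -
    have "((\<lambda>x. poly C (a + x)) \<longlongrightarrow> poly C (a + 0)) (nhds 0)"
      by (intro tendsto_intros filterlim_ident)
    then have "eventually (\<lambda>x. poly C (a + x) \<noteq> 0) (nhds 0)"
      by (rule tendsto_imp_eventually_ne) (use C0 in simp)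
    then show ?thesis
      by eventually_elim (auto simp: C'_def poly_pcompose)
  qed
  ultimately have "(\<lambda>x. 1) has_fps_expansion fps_of_poly C' * R"
    by (subst (asm) has_fps_expansion_cong[OF _ refl])
  then have one: "fps_of_poly C' * R = 1"
    using fps_expansion_unique_complex has_fps_expansion_1 by blast
  have "monom 1 n dvd C' * T - 1"
    unfolding monom_1_dvd_iff'
  proof (intro allI impI)
    fix k assume k: "k < n"
    have "coeff (C' * T) k = (\<Sum>i\<le>k. coeff C' i * coeff T (k - i))"
      by (simp add: coeff_mult)
    also have "\<dots> = (\<Sum>i\<le>k. fps_nth (fps_of_poly C') i * fps_nth R (k - i))"
    proof (rule sum.cong[OF refl])
      fix i assume "i \<in> {..k}"
      then have "coeff T (k - i) = recip_coeff K pt \<mu> j (k - i)"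
        using k by (simp add: T_def coeff_sum)
      also have "\<dots> = fps_nth R (k - i)"
        by (simp add: R_def fps_expansion_def recip_coeff_def C_def a_def)
      finally show "coeff C' i * coeff T (k - i) = fps_nth (fps_of_poly C') i * fps_nth R (k - i)"
        by simp
    qed
    also have "\<dots> = fps_nth (fps_of_poly C' * R) k"
      by (simp add: fps_mult_nth atLeast0AtMost)
    finally show "coeff (C' * T - 1) k = 0"
      by (simp add: one)
  qed
  then obtain D where D: "C' * T - 1 = monom 1 n * D" by (elim dvdE)
  have "pcompose (C' * T - 1) [:- a, 1:] = [:- a, 1:] ^ n * pcompose D [:- a, 1:]"
    unfolding D pcompose_mult by (simp add: monom_altdef pcompose_power pcompose_smult pcompose_pCons)
  moreover have "pcompose (C' * T - 1) [:- a, 1:] =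
     C * (\<Sum>i<n. smult (recip_coeff K pt \<mu> j i) ([:- a, 1:] ^ i)) - 1"
    by (simp add: C'_def T_def pcompose_diff pcompose_mult pcompose_sum pcompose_assoc[symmetric] pcompose_pCons
        monom_altdef pcompose_smult pcompose_power pcompose_1)
  ultimately show ?thesis
    unfolding C_def a_def by (metis dvd_triv_left)
qed

lemma degree_linear_power_le: "degree ([:- a, 1:] ^ n :: complex poly) \<le> n"
  using degree_power_le[of "[:- a, 1:]" n] by simp

lemma degree_cofactor_le:
  assumes "finite K"
  shows "degree (cofactor K pt \<mu> j) \<le> (\<Sum>k\<in>K - {j}. \<mu> k)"
proof -
  have "degree (\<Prod>k\<in>K - {j}. [:- pt k, 1:] ^ \<mu> k) \<le> (\<Sum>k\<in>K - {j}. degree ([:- pt k, 1:] ^ \<mu> k))"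
    by (rule order.trans[OF degree_prod_sum_le]) (use assms in auto)
  also have "\<dots> \<le> (\<Sum>k\<in>K - {j}. \<mu> k)"
    by (intro sum_mono degree_linear_power_le)
  finally show ?thesis
    unfolding cofactor_def by (rule order.trans[OF degree_smult_le])
qed

text \<open>Truncating the reciprocal at order \<open>\<mu> j - l\<close> keeps the factor belonging
  to node \<open>j\<close> at degree at most \<open>\<mu> j - 1\<close>, and the cofactor supplies
  the multiplicities of the other nodes. The alternative of a zero polynomial is there for empty
  \<open>K\<close>, where no degree is below the empty sum.\<close>

lemma degree_hermite_poly:
  assumes K: "finite K" and \<mu>: "\<And>k. k \<in> K \<Longrightarrow> \<mu> k \<ge> 1"
  shows "hermite_poly K pt \<mu> c = 0 \<or> degree (hermite_poly K pt \<mu> c) < (\<Sum>k\<in>K. \<mu> k)"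
proof (cases "K = {}")
  case True
  then show ?thesis by (simp add: hermite_poly_def)
next
  case False
  then have pos: "(\<Sum>k\<in>K. \<mu> k) \<ge> 1"
    using K \<mu> by (metis One_nat_def Suc_leI bot_nat_0.not_eq_extremum ex_in_conv not_one_le_zero sum_eq_0_iff)
  have "degree (hermite_poly K pt \<mu> c) \<le> (\<Sum>k\<in>K. \<mu> k) - 1"
    unfolding hermite_poly_def
  proof (rule degree_sum_le[OF K])
    fix j assume j: "j \<in> K"
    have "degree (\<Sum>l<\<mu> j. smult (c j l) ([:- pt j, 1:] ^ l) *
           (\<Sum>i<\<mu> j - l. smult (recip_coeff K pt \<mu> j i) ([:- pt j, 1:] ^ i))) \<le> \<mu> j - 1" (is "degree ?S \<le> _")
    proof (rule degree_sum_le)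
      fix l assume l: "l \<in> {..<\<mu> j}"
      have 1: "degree (smult (c j l) ([:- pt j, 1:] ^ l)) \<le> l"
        by (rule order.trans[OF degree_smult_le degree_linear_power_le])
      have "degree (\<Sum>i<\<mu> j - l. smult (recip_coeff K pt \<mu> j i) ([:- pt j, 1:] ^ i)) \<le> \<mu> j - l - 1"
      proof (rule degree_sum_le)
        fix i assume "i \<in> {..<\<mu> j - l}"
        then show "degree (smult (recip_coeff K pt \<mu> j i) ([:- pt j, 1:] ^ i)) \<le> \<mu> j - l - 1"
          by (intro order.trans[OF degree_smult_le] order.trans[OF degree_linear_power_le]) auto
      qed auto
      then show "degree (smult (c j l) ([:- pt j, 1:] ^ l) *
           (\<Sum>i<\<mu> j - l. smult (recip_coeff K pt \<mu> j i) ([:- pt j, 1:] ^ i))) \<le> \<mu> j - 1"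
        using 1 l by (intro order.trans[OF degree_mult_le]) auto
    qed auto
    then have "degree (cofactor K pt \<mu> j * ?S) \<le> (\<Sum>k\<in>K - {j}. \<mu> k) + (\<mu> j - 1)"
      by (intro order.trans[OF degree_mult_le] add_mono degree_cofactor_le K)
    also have "\<dots> = (\<Sum>k\<in>K. \<mu> k) - 1"
      using K j \<mu>[OF j] by (simp add: sum.remove)
    finally show "degree (cofactor K pt \<mu> j * ?S) \<le> (\<Sum>k\<in>K. \<mu> k) - 1" .
  qed
  then show ?thesis using pos by linarith
qed

definition node_poly :: "nat set \<Rightarrow> (nat \<Rightarrow> complex) \<Rightarrow> (nat \<Rightarrow> nat) \<Rightarrow> complex poly" where
  "node_poly K pt \<mu> = (\<Prod>k\<in>K. [:- pt k, 1:] ^ \<mu> k)"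

lemma degree_node_poly: "finite K \<Longrightarrow> degree (node_poly K pt \<mu>) = (\<Sum>k\<in>K. \<mu> k)"
  unfolding node_poly_def by (subst degree_prod_eq_sum_degree) (auto simp: degree_linear_power)

lemma poly_node_poly: "poly (node_poly K pt \<mu>) w = node_prod K pt \<mu> 1 w"
  by (simp add: node_poly_def node_prod_def poly_prod)

text \<open>This is the interpolation property: the Taylor coefficients at \<open>pt j\<close> below
  order \<open>\<mu> j\<close> are the prescribed ones. The summands of the other nodes contain the
  factor of \<open>j\<close> to full order. In the summand of \<open>j\<close> the truncated
  reciprocal undoes the cofactor up to order \<open>\<mu> j - l\<close>, and the factor
  \<open>X ^ l\<close> raises this to \<open>\<mu> j\<close>.\<close>

lemma hermite_poly_congruence:
  assumes K: "finite K" "inj_on pt K" and j: "j \<in> K"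
  shows "[:- pt j, 1:] ^ \<mu> j dvd
    hermite_poly K pt \<mu> c - (\<Sum>l<\<mu> j. smult (c j l) ([:- pt j, 1:] ^ l))"
proof -
  define X where "X = [:- pt j, 1:]"
  define Q where "Q = (\<lambda>j. (\<Sum>l<\<mu> j. smult (c j l) ([:- pt j, 1:] ^ l) *
           (\<Sum>i<\<mu> j - l. smult (recip_coeff K pt \<mu> j i) ([:- pt j, 1:] ^ i))))"
  have "X ^ \<mu> j dvd cofactor K pt \<mu> i * Q i" if "i \<in> K - {j}" for i
  proof -
    have "X ^ \<mu> j dvd (\<Prod>k\<in>K - {i}. [:- pt k, 1:] ^ \<mu> k)"
      unfolding X_def by (rule dvd_prodI) (use that j K in auto)
    then show ?thesis
      unfolding cofactor_def by (intro dvd_mult2 dvd_smult)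
  qed
  then have 1: "X ^ \<mu> j dvd (\<Sum>i\<in>K - {j}. cofactor K pt \<mu> i * Q i)"
    by (rule dvd_sum)
  have 2: "X ^ \<mu> j dvd cofactor K pt \<mu> j * Q j - (\<Sum>l<\<mu> j. smult (c j l) (X ^ l))"
  proof -
    have "X ^ \<mu> j dvd smult (c j l) (X ^ l * (cofactor K pt \<mu> j *
       (\<Sum>i<\<mu> j - l. smult (recip_coeff K pt \<mu> j i) (X ^ i)) - 1))" if "l < \<mu> j" for l
    proof (rule dvd_smult)
      have "X ^ l * X ^ (\<mu> j - l) dvd X ^ l * (cofactor K pt \<mu> j *
         (\<Sum>i<\<mu> j - l. smult (recip_coeff K pt \<mu> j i) (X ^ i)) - 1)"
        unfolding X_def by (intro mult_dvd_mono cofactor_recip_coeff_dvd assms dvd_refl)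
      then show "X ^ \<mu> j dvd X ^ l * (cofactor K pt \<mu> j *
         (\<Sum>i<\<mu> j - l. smult (recip_coeff K pt \<mu> j i) (X ^ i)) - 1)"
        using that by (simp flip: power_add)
    qed
    then have "X ^ \<mu> j dvd (\<Sum>l<\<mu> j. smult (c j l) (X ^ l * (cofactor K pt \<mu> j *
       (\<Sum>i<\<mu> j - l. smult (recip_coeff K pt \<mu> j i) (X ^ i)) - 1)))"
      by (intro dvd_sum) auto
    also have "\<dots> = cofactor K pt \<mu> j * Q j - (\<Sum>l<\<mu> j. smult (c j l) (X ^ l))"
      by (simp add: Q_def X_def sum_subtractf sum_distrib_left algebra_simps smult_diff_right smult_sum_right)
    finally show ?thesis .
  qed
  have "hermite_poly K pt \<mu> c = (\<Sum>i\<in>K - {j}. cofactor K pt \<mu> i * Q i) + cofactor K pt \<mu> j * Q j"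
    unfolding hermite_poly_def Q_def using K j by (simp add: sum.remove algebra_simps)
  then show ?thesis
    using dvd_add[OF 1 2] by (simp add: X_def algebra_simps)
qed

text \<open>Powers at distinct nodes are coprime. This enters through root orders: the product over
  the other nodes has order 0 at \<open>pt j\<close>, so the power at \<open>pt j\<close> has to
  divide the complementary factor \<open>r\<close>.\<close>

lemma node_poly_dvd:
  assumes "finite K" "inj_on pt K" "\<And>j. j \<in> K \<Longrightarrow> [:- pt j, 1:] ^ \<mu> j dvd q"
  shows "node_poly K pt \<mu> dvd q"
  using assms
proof (induction K rule: finite_induct)
  case empty
  then show ?case by (simp add: node_poly_def)
next
  case (insert j K)
  then obtain r where r: "q = node_poly K pt \<mu> * r" by (auto elim!: dvdE)
  have nz: "node_poly K pt \<mu> \<noteq> 0"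
    using insert.hyps by (simp add: node_poly_def)
  have "order (pt j) (node_poly K pt \<mu>) = 0"
    using insert.hyps insert.prems(1)
    by (intro order_0I) (auto simp: node_poly_def poly_prod inj_on_def)
  moreover have "[:- pt j, 1:] ^ \<mu> j dvd q"
    using insert.prems by simp
  ultimately have "[:- pt j, 1:] ^ \<mu> j dvd r"
    using nz by (cases "r = 0") (auto simp: order_divides r order_mult)
  then show ?case
    using insert.hyps by (simp add: r node_poly_def mult.commute[of "_ ^ _"] mult_dvd_mono)
qed

text \<open>The coefficients are the Taylor coefficients of 1/(w - x) at the nodes, so
  \<open>D\<close>, that is 1 - (w - x) H(x), vanishes at each node to its full multiplicity. Its
  degree is at most that of the node polynomial, hence it is a constant multiple of it.\<close>

lemma hermite_poly_Cauchy_kernel: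
  assumes K: "finite K" "inj_on pt K" "\<And>k. k \<in> K \<Longrightarrow> \<mu> k \<ge> 1"
    and w: "w \<notin> pt ` K" "w \<noteq> z"
  shows "poly (hermite_poly K pt \<mu> (\<lambda>j l. 1 / (w - pt j) ^ (l + 1))) z =
    (1 - node_prod K pt \<mu> 1 z / node_prod K pt \<mu> 1 w) / (w - z)"
proof -
  define H where "H = hermite_poly K pt \<mu> (\<lambda>j l. 1 / (w - pt j) ^ (l + 1))"
  define D where "D = 1 - [:w, -1:] * H"
  have "node_poly K pt \<mu> dvd D"
  proof (rule node_poly_dvd[OF K(1,2)])
    fix j assume j: "j \<in> K"
    define X where "X = [:- pt j, 1:]"
    define y where "y = w - pt j"
    define S where "S = (\<Sum>l<\<mu> j. smult (1 / y ^ (l + 1)) (X ^ l))"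
    have y: "y \<noteq> 0" using w j by (auto simp: y_def)
    \<comment> \<open>In the local variable at \<open>pt j\<close> the factor w - x is
      \<open>y\<close> minus \<open>X\<close>, and multiplying the geometric sum \<open>S\<close> by
      it telescopes.\<close>
    have "[:w, -1:] * S = [:y:] * S - X * S"
      by (simp add: X_def y_def smult_diff_left)
    also have "[:y:] * S - X * S = (\<Sum>l<\<mu> j. smult (1 / y ^ l) (X ^ l) - smult (1 / y ^ Suc l) (X ^ Suc l))"
      using y by (simp add: S_def sum_distrib_left sum_subtractf smult_sum_right)
    also have "\<dots> = 1 - smult (1 / y ^ \<mu> j) (X ^ \<mu> j)"
      by (subst sum_lessThan_telescope') simp
    finally have "D = smult (1 / y ^ \<mu> j) (X ^ \<mu> j) - [:w, -1:] * (H - S)"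
      unfolding D_def by (simp only: right_diff_distrib) simp
    moreover have "X ^ \<mu> j dvd H - S"
      unfolding H_def X_def S_def y_def by (rule hermite_poly_congruence[OF K(1,2) j])
    ultimately show "X ^ \<mu> j dvd D"
      by (metis dvd_diff dvd_mult dvd_smult dvd_refl)
  qed
  then obtain E where E: "D = node_poly K pt \<mu> * E" by (elim dvdE)
  have "degree D \<le> (\<Sum>k\<in>K. \<mu> k)"
  proof -
    have "degree ([:w, -1:] * H) \<le> (\<Sum>k\<in>K. \<mu> k)"
    proof -
      have "H = 0 \<or> degree H < (\<Sum>k\<in>K. \<mu> k)"
        unfolding H_def using K by (intro degree_hermite_poly) auto
      moreover have "degree ([:w, -1:] * H) \<le> 1 + degree H"
        by (rule order.trans[OF degree_mult_le]) auto
      ultimately show ?thesis by (auto simp del: mult_pCons_left)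
    qed
    then show ?thesis unfolding D_def by (intro degree_diff_le) auto
  qed
  moreover have "node_poly K pt \<mu> \<noteq> 0" using K by (simp add: node_poly_def)
  ultimately have "degree E = 0"
    using degree_mult_eq[of "node_poly K pt \<mu>" E] degree_node_poly[OF K(1), of pt \<mu>]
    by (cases "E = 0") (auto simp: E)
  then obtain e where e: "E = [:e:]" by (rule degree_eq_zeroE)
  have ev: "1 - (w - x) * poly H x = e * node_prod K pt \<mu> 1 x" for x
  proof -
    have "poly D x = poly (node_poly K pt \<mu> * E) x" using E by simp
    then show ?thesis by (simp add: D_def e poly_node_poly algebra_simps)
  qed
  have "node_prod K pt \<mu> 1 w \<noteq> 0" using w K(1) by (auto simp: node_prod_def)
  \<comment> \<open>At x = w the term with \<open>H\<close> disappears, which determines the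
    constant.\<close>
  then have "e = 1 / node_prod K pt \<mu> 1 w"
    using ev[of w] by (simp add: field_simps)
  then have "1 - (w - z) * poly H z = node_prod K pt \<mu> 1 z / node_prod K pt \<mu> 1 w"
    using ev[of z] by simp
  then show ?thesis using w(2) unfolding H_def[symmetric] by (simp add: field_simps)
qed

text \<open>The value at \<open>z\<close> is linear in the interpolated coefficients, with weights
  \<open>d j l\<close>. Coefficients that are integrals of \<open>g\<close> times the Taylor
  coefficients of the Cauchy kernel therefore give the integral of \<open>g\<close> times the
  interpolant of that kernel. The constant \<open>C\<close> is going to be 1/(2 pi i).\<close>

lemma contour_integral_hermite_poly:
  assumes K: "finite K" "inj_on pt K" "\<And>k. k \<in> K \<Longrightarrow> \<mu> k \<ge> 1"
    and \<gamma>: "valid_path \<gamma>" "pt ` K \<inter> path_image \<gamma> = {}" "z \<notin> path_image \<gamma>"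
    and g: "\<And>j l. j \<in> K \<Longrightarrow> (\<lambda>w. g w / (w - pt j) ^ (l + 1)) contour_integrable_on \<gamma>"
  shows "poly (hermite_poly K pt \<mu> (\<lambda>j l. C * contour_integral \<gamma> (\<lambda>w. g w / (w - pt j) ^ (l + 1)))) z =
    C * contour_integral \<gamma> (\<lambda>w. g w * (1 - node_prod K pt \<mu> 1 z / node_prod K pt \<mu> 1 w) / (w - z))"
proof -
  define d where "d = (\<lambda>j l. poly (cofactor K pt \<mu> j) z * ((z - pt j) ^ l *
           (\<Sum>i<\<mu> j - l. recip_coeff K pt \<mu> j i * (z - pt j) ^ i)))"
  have ev: "poly (hermite_poly K pt \<mu> c) z = (\<Sum>j\<in>K. \<Sum>l<\<mu> j. d j l * c j l)" for c
    by (simp add: hermite_poly_def poly_sum d_def sum_distrib_left mult_ac)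
  have int: "((\<lambda>w. \<Sum>j\<in>K. \<Sum>l<\<mu> j. d j l * (g w / (w - pt j) ^ (l + 1))) has_contour_integral
    (\<Sum>j\<in>K. \<Sum>l<\<mu> j. d j l * contour_integral \<gamma> (\<lambda>w. g w / (w - pt j) ^ (l + 1)))) \<gamma>"
    by (intro has_contour_integral_sum has_contour_integral_lmul has_contour_integral_integral g K finite_lessThan)
  have "contour_integral \<gamma> (\<lambda>w. g w * (1 - node_prod K pt \<mu> 1 z / node_prod K pt \<mu> 1 w) / (w - z)) =
    contour_integral \<gamma> (\<lambda>w. \<Sum>j\<in>K. \<Sum>l<\<mu> j. d j l * (g w / (w - pt j) ^ (l + 1)))"
  proof (rule contour_integral_cong[OF refl])
    fix w assume w: "w \<in> path_image \<gamma>"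
    have "(\<Sum>j\<in>K. \<Sum>l<\<mu> j. d j l * (g w / (w - pt j) ^ (l + 1))) =
       g w * poly (hermite_poly K pt \<mu> (\<lambda>j l. 1 / (w - pt j) ^ (l + 1))) z"
      unfolding ev by (simp add: sum_distrib_left mult_ac)
    also have "poly (hermite_poly K pt \<mu> (\<lambda>j l. 1 / (w - pt j) ^ (l + 1))) z =
        (1 - node_prod K pt \<mu> 1 z / node_prod K pt \<mu> 1 w) / (w - z)"
      by (rule hermite_poly_Cauchy_kernel) (use K \<gamma> w in auto)
    finally show "g w * (1 - node_prod K pt \<mu> 1 z / node_prod K pt \<mu> 1 w) / (w - z) =
      (\<Sum>j\<in>K. \<Sum>l<\<mu> j. d j l * (g w / (w - pt j) ^ (l + 1)))" by simp
  qed
  also have "\<dots> = (\<Sum>j\<in>K. \<Sum>l<\<mu> j. d j l * contour_integral \<gamma> (\<lambda>w. g w / (w - pt j) ^ (l + 1)))"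
    using int by (rule contour_integral_unique)
  finally show ?thesis
    unfolding ev by (simp add: sum_distrib_left mult_ac)
qed

subsection \<open>Loop integrals as integrals over segments\<close>

text \<open>In the last conclusion \<open>h\<close> need only be holomorphic near the loop, so
  rational kernels with poles elsewhere are allowed. Since the segments are chosen before the loop,
  the same family can serve two loops at once.\<close>

lemma Cauchy_segments:
  assumes K: "compact K" "open V" "K \<subseteq> V" and f: "f holomorphic_on V"
  obtains n :: nat and a b :: "nat \<Rightarrow> complex"
  where "\<And>i. i < n \<Longrightarrow> closed_segment (a i) (b i) \<subseteq> V - K"
    and "\<And>x. x \<in> K \<Longrightarrow>
      2 * of_real pi * \<i> * f x = (\<Sum>i<n. contour_integral (linepath (a i) (b i)) (\<lambda>v. f v / (v - x)))"
    and "\<And>\<gamma> h S. valid_path \<gamma> \<Longrightarrow> path_image \<gamma> \<subseteq> K \<inter> S \<Longrightarrow> open S \<Longrightarrow> h holomorphic_on S \<Longrightarrow>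
      2 * of_real pi * \<i> * contour_integral \<gamma> (\<lambda>w. f w * h w) =
      (\<Sum>i<n. contour_integral (linepath (a i) (b i)) (\<lambda>v. f v * contour_integral \<gamma> (\<lambda>w. h w / (v - w))))"
proof -
  obtain n :: nat and a b :: "nat \<Rightarrow> complex" where
    seg: "\<And>i. i < n \<Longrightarrow> closed_segment (a i) (b i) \<subseteq> V - K" and
    rep: "\<And>f x. f holomorphic_on V \<Longrightarrow> x \<in> K \<Longrightarrow>
      2 * of_real pi * \<i> * f x = (\<Sum>i<n. contour_integral (linepath (a i) (b i)) (\<lambda>v. f v / (v - x)))"
    by (rule Cauchy_formula_segments[OF K]) (rule that)
  show ?thesis
  proof (rule that[OF seg rep[OF f]])
    fix \<gamma> h S
    assume \<gamma>: "valid_path \<gamma>" "path_image \<gamma> \<subseteq> K \<inter> S" and S: "open S" "h holomorphic_on S"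
    have cont: "continuous_on (closed_segment (a i) (b i)) f" if "i < n" for i
      using seg[OF that] f by (intro holomorphic_on_imp_continuous_on[OF holomorphic_on_subset]) auto
    have int: "(\<lambda>w. contour_integral (linepath (a i) (b i)) (\<lambda>v. f v / (v - w)) * h w) contour_integrable_on \<gamma>"
      if "i < n" for i
    proof (rule contour_integrable_holomorphic_simple[OF _ _ \<gamma>(1)])
      show "open (S - closed_segment (a i) (b i))" using S by auto
      show "(\<lambda>w. contour_integral (linepath (a i) (b i)) (\<lambda>v. f v / (v - w)) * h w)
        holomorphic_on S - closed_segment (a i) (b i)"
        by (intro holomorphic_intros holomorphic_on_subset[OF S(2)]
          holomorphic_on_subset[OF Cauchy_transform_linepath_holomorphic[OF cont[OF that]]]) auto
      show "path_image \<gamma> \<subseteq> S - closed_segment (a i) (b i)" using \<gamma>(2) seg[OF that] by auto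
    qed
    have "2 * of_real pi * \<i> * contour_integral \<gamma> (\<lambda>w. f w * h w) =
      contour_integral \<gamma> (\<lambda>w. 2 * of_real pi * \<i> * (f w * h w))"
    proof (rule contour_integral_lmul[symmetric])
      show "(\<lambda>w. f w * h w) contour_integrable_on \<gamma>"
      proof (rule contour_integrable_holomorphic_simple[OF _ _ \<gamma>(1)])
        show "open (V \<inter> S)" using S K by auto
        show "(\<lambda>w. f w * h w) holomorphic_on V \<inter> S"
          by (intro holomorphic_intros holomorphic_on_subset[OF f] holomorphic_on_subset[OF S(2)]) auto
      qed (use \<gamma> K in auto)
    qed
    also have "\<dots> = contour_integral \<gamma>
        (\<lambda>w. \<Sum>i<n. contour_integral (linepath (a i) (b i)) (\<lambda>v. f v / (v - w)) * h w)"
    proof (rule contour_integral_cong[OF refl])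
      fix w assume "w \<in> path_image \<gamma>"
      then have w: "w \<in> K" using \<gamma>(2) by auto
      show "2 * of_real pi * \<i> * (f w * h w) =
        (\<Sum>i<n. contour_integral (linepath (a i) (b i)) (\<lambda>v. f v / (v - w)) * h w)"
        unfolding sum_distrib_right[symmetric] rep[OF f w, symmetric] by simp
    qed
    also have "\<dots> = (\<Sum>i<n. contour_integral \<gamma>
        (\<lambda>w. contour_integral (linepath (a i) (b i)) (\<lambda>v. f v / (v - w)) * h w))"
      by (rule contour_integral_sum) (auto intro: int)
    also have "\<dots> = (\<Sum>i<n. contour_integral (linepath (a i) (b i))
        (\<lambda>v. f v * contour_integral \<gamma> (\<lambda>w. h w / (v - w))))"
    proof (intro sum.cong refl)
      fix i assume "i \<in> {..<n}"
      then have i: "i < n" by simp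
      show "contour_integral \<gamma> (\<lambda>w. contour_integral (linepath (a i) (b i)) (\<lambda>v. f v / (v - w)) * h w) =
        contour_integral (linepath (a i) (b i)) (\<lambda>v. f v * contour_integral \<gamma> (\<lambda>w. h w / (v - w)))"
        by (rule contour_integral_swap_linepath[OF \<gamma>(1) S(1) _ S(2) cont[OF i]])
          (use \<gamma> seg[OF i] in auto)
    qed
    finally show "2 * of_real pi * \<i> * contour_integral \<gamma> (\<lambda>w. f w * h w) =
      (\<Sum>i<n. contour_integral (linepath (a i) (b i)) (\<lambda>v. f v * contour_integral \<gamma> (\<lambda>w. h w / (v - w))))" .
  qed
qed

text \<open>Cauchy's formula in its homology form; the minus sign is due to the kernel 1/(v -
  w).\<close>

lemma contour_integral_Cauchy_kernel:
  assumes "open S" "h holomorphic_on S" "v \<in> S" "valid_path \<gamma>" "path_image \<gamma> \<subseteq> S - {v}"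
    "pathfinish \<gamma> = pathstart \<gamma>" "\<And>w. w \<notin> S \<Longrightarrow> winding_number \<gamma> w = 0"
  shows "contour_integral \<gamma> (\<lambda>w. h w / (v - w)) = - (2 * of_real pi * \<i> * winding_number \<gamma> v * h v)"
proof -
  have "((\<lambda>w. - (h w / (w - v))) has_contour_integral - (2 * pi * \<i> * winding_number \<gamma> v * h v)) \<gamma>"
    by (intro has_contour_integral_neg Cauchy_integral_formula_global[OF assms])
  moreover have "(\<lambda>w. - (h w / (w - v))) = (\<lambda>w. h w / (v - w))"
    by (rule ext) (metis minus_diff_eq minus_divide_right)
  ultimately show ?thesis by (auto dest: contour_integral_unique)
qed

text \<open>On each segment \<open>G\<close> is bounded, so the integrand is dominated by a constant
  times \<open>\<theta> ^ N\<close>. Where \<open>G v = 0\<close> nothing is asked of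
  \<open>H v\<close>: in the applications \<open>G\<close> contains the winding number weight, which
  vanishes at the points where the quotient \<open>H\<close> may be large.\<close>

lemma tendsto_sum_contour_integral_power:
  fixes a b :: "nat \<Rightarrow> complex"
  assumes G: "\<And>i. i < n \<Longrightarrow> continuous_on (closed_segment (a i) (b i)) G"
    and H: "\<And>i. i < n \<Longrightarrow> continuous_on (closed_segment (a i) (b i)) H"
    and \<theta>: "0 \<le> \<theta>" "\<theta> < 1"
    and le: "\<And>i v. i < n \<Longrightarrow> v \<in> closed_segment (a i) (b i) \<Longrightarrow> G v = 0 \<or> norm (H v) \<le> \<theta>"
  shows "(\<lambda>N. \<Sum>i<n. contour_integral (linepath (a i) (b i)) (\<lambda>v. G v * H v ^ N)) \<longlonglongrightarrow> 0"
proof (rule tendsto_null_sum)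
  fix i assume "i \<in> {..<n}"
  then have i: "i < n" by simp
  obtain M where M: "\<And>v. v \<in> closed_segment (a i) (b i) \<Longrightarrow> norm (G v) \<le> M"
    using compact_imp_bounded[OF compact_continuous_image[OF G[OF i] compact_segment]]
    by (auto simp: bounded_iff)
  have M0: "0 \<le> M" using M[OF ends_in_segment(1)] by (rule order.trans[OF norm_ge_zero])
  have le: "norm (contour_integral (linepath (a i) (b i)) (\<lambda>v. G v * H v ^ N)) \<le> M * \<theta> ^ N * norm (b i - a i)" for N
  proof (rule contour_integral_bound_linepath)
    show "(\<lambda>v. G v * H v ^ N) contour_integrable_on linepath (a i) (b i)"
      by (intro contour_integrable_continuous_linepath continuous_on_mult continuous_on_power G[OF i] H[OF i])
    show "norm (G v * H v ^ N) \<le> M * \<theta> ^ N" if "v \<in> closed_segment (a i) (b i)" for v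
    proof (cases "G v = 0")
      case False
      then show ?thesis
        using le[OF i that] M[OF that] M0 by (auto simp: norm_mult norm_power intro!: mult_mono power_mono)
    qed (use M0 \<theta> in auto)
  qed (use M0 \<theta> in auto)
  have "(\<lambda>N. M * \<theta> ^ N * norm (b i - a i)) \<longlonglongrightarrow> M * 0 * norm (b i - a i)"
    by (intro tendsto_mult tendsto_const LIMSEQ_power_zero) (use \<theta> in auto)
  then have "(\<lambda>N. M * \<theta> ^ N * norm (b i - a i)) \<longlonglongrightarrow> 0" by simp
  then show "(\<lambda>N. contour_integral (linepath (a i) (b i)) (\<lambda>v. G v * H v ^ N)) \<longlonglongrightarrow> 0"
    by (rule Lim_null_comparison[rotated]) (intro always_eventually allI le)
qed

section \<open>Node products: powers, zeros and growth\<close>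

lemma node_prod_power: "node_prod K pt \<mu> n w = node_prod K pt \<mu> 1 w ^ n"
  unfolding node_prod_def prod_power_distrib
  by (intro prod.cong refl) (simp add: mult.commute flip: power_mult)

text \<open>The list contains \<open>n * \<mu> k\<close> copies of \<open>pt k\<close>. Only an
  inclusion of root sets is claimed, since for n = 0 the list is empty.\<close>

lemma node_prod_eq_prod_diff:
  assumes "finite K"
  obtains as where "set as \<subseteq> pt ` K" "\<And>w. node_prod K pt \<mu> n w = prod_diff as w"
proof -
  have "\<exists>as. set as \<subseteq> pt ` K \<and> (\<forall>w. node_prod K pt \<mu> n w = prod_diff as w)"
    using assms
  proof (induction K)
    case empty
    show ?case by (intro exI[of _ "[]"]) (auto simp: node_prod_def)
  next
    case (insert k K)
    then obtain as where as: "set as \<subseteq> pt ` K" "\<And>w. node_prod K pt \<mu> n w = prod_diff as w" by auto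
    from as(2) have "(\<Prod>k\<in>K. (w - pt k) ^ (n * \<mu> k)) = prod_diff as w" for w
      by (simp add: node_prod_def)
    moreover have "prod_diff (replicate r x @ as) w = (w - x) ^ r * prod_diff as w" for r x w
      by (induction r) (auto simp: mult_ac)
    ultimately show ?case
      using insert.hyps as(1)
      by (intro exI[of _ "replicate (n * \<mu> k) (pt k) @ as"] conjI allI)
        (auto simp: node_prod_def[abs_def] set_replicate_conv_if)
  qed
  then show ?thesis using that by blast
qed

lemma holomorphic_on_node_prod [holomorphic_intros]: "node_prod K pt \<mu> n holomorphic_on S"
  unfolding node_prod_def[abs_def] by (intro holomorphic_intros)

lemma node_prod_eq_0D: "node_prod K pt \<mu> n w = 0 \<Longrightarrow> w \<in> pt ` K"
  unfolding node_prod_def by (cases "finite K") auto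

lemma norm_node_prod: "norm (node_prod K pt \<mu> 1 w) = node_abs K pt \<mu> w"
  by (simp add: node_prod_def node_abs_def norm_power flip: prod_norm)

lemma continuous_on_node_abs: "continuous_on S (node_abs K pt \<mu>)"
  unfolding node_abs_def[abs_def] by (intro continuous_intros)

text \<open>At distance at least R = |r| + 1 from every node all factors are at least 1 and one of
  them is at least R > r. So the sublevel set is covered by finitely many balls.\<close>

lemma bounded_node_abs_le:
  assumes K: "finite K" "K \<noteq> {}" "\<And>k. k \<in> K \<Longrightarrow> \<mu> k \<ge> 1"
  shows "bounded {w. node_abs K pt \<mu> w \<le> r}"
proof -
  define R where "R = \<bar>r\<bar> + 1"
  have "{w. node_abs K pt \<mu> w \<le> r} \<subseteq> (\<Union>k\<in>K. cball (pt k) R)"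
  proof (rule subsetI, rule ccontr)
    fix w assume w: "w \<in> {w. node_abs K pt \<mu> w \<le> r}" "w \<notin> (\<Union>k\<in>K. cball (pt k) R)"
    then have far: "R \<le> norm (w - pt k)" if "k \<in> K" for k
      using that by (force simp: dist_norm norm_minus_commute)
    obtain k0 where k0: "k0 \<in> K" using K by auto
    have R1: "1 \<le> R" by (simp add: R_def)
    have "R ^ 1 \<le> R ^ \<mu> k0" using R1 K(3)[OF k0] by (intro power_increasing) auto
    also have "\<dots> \<le> norm (w - pt k0) ^ \<mu> k0" using far[OF k0] R1 by (intro power_mono) auto
    also have "\<dots> = norm (w - pt k0) ^ \<mu> k0 * 1" by simp
    also have "\<dots> \<le> norm (w - pt k0) ^ \<mu> k0 * (\<Prod>k\<in>K - {k0}. norm (w - pt k) ^ \<mu> k)"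
    proof (intro mult_left_mono prod_ge_1 one_le_power)
      show "1 \<le> norm (w - pt k)" if "k \<in> K - {k0}" for k
        using far[of k] R1 that by simp
    qed simp
    also have "\<dots> = node_abs K pt \<mu> w"
      unfolding node_abs_def using K k0 by (simp add: prod.remove)
    finally show False using w(1) by (simp add: R_def)
  qed
  moreover have "bounded (\<Union>k\<in>K. cball (pt k) R)" using K by auto
  ultimately show ?thesis by (rule bounded_subset[rotated])
qed

section \<open>Winding numbers and nested loops\<close>

lemma ccw_loop_winding_outside:
  assumes "ccw_loop \<gamma>" "v \<in> outside (path_image \<gamma>)"
  shows "winding_number \<gamma> v = 0"
  using assms by (auto simp: ccw_loop_def intro!: winding_number_zero_in_outside valid_path_imp_path)

text \<open>By the Jordan curve theorem the complement of the inside of \<open>\<gamma>\<close> is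
  the closure of the outside, hence connected and unbounded. It does not meet \<open>T\<close>, so
  no bounded component of the complement of \<open>T\<close> can reach it.\<close>

lemma inside_subset_inside:
  assumes \<gamma>: "ccw_loop \<gamma>" and "compact T" "T \<subseteq> inside (path_image \<gamma>)"
  shows "inside T \<subseteq> inside (path_image \<gamma>)"
proof -
  have sc: "simple_path \<gamma>" "pathfinish \<gamma> = pathstart \<gamma>" using \<gamma> by (auto simp: ccw_loop_def)
  note J = Jordan_inside_outside[OF sc]
  have "- inside (path_image \<gamma>) = closure (outside (path_image \<gamma>))"
  proof -
    have "closure (outside (path_image \<gamma>)) = outside (path_image \<gamma>) \<union> path_image \<gamma>"
      using J by (metis closure_Un_frontier)
    then show ?thesis using J by blast
  qed
  then have "connected (- inside (path_image \<gamma>))"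
    using J by (simp add: connected_imp_connected_closure)
  moreover have "\<not> bounded (- inside (path_image \<gamma>))"
    using J by (metis bounded_Un cobounded_imp_unbounded compl_le_swap2 double_compl)
  ultimately have "inside T \<subseteq> inside (path_image \<gamma>) - T"
    by (rule inside_subset) (use assms(3) in auto)
  then show ?thesis by auto
qed

subsection \<open>The expansion for a pair of loops\<close>

locale two_loop_expansion =
  fixes \<Omega> \<Omega>0 :: "complex set" and f :: "complex \<Rightarrow> complex"
    and pt :: "nat \<Rightarrow> complex" and \<mu> :: "nat \<Rightarrow> nat" and p q :: nat
    and z :: complex and \<Gamma>1 \<Gamma>2 :: "real \<Rightarrow> complex"
  assumes closed_\<Omega>0: "closed \<Omega>0" and open_\<Omega>: "open \<Omega>"
    and hol: "f holomorphic_on \<Omega> - \<Omega>0"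
    and p: "p \<ge> 1" and q: "q \<le> p"
    and inj: "inj_on pt {1..p}"
    and mult: "\<And>k. k \<in> {1..p} \<Longrightarrow> \<mu> k \<ge> 1"
    and outer: "pt ` {1..q} \<subseteq> \<Omega> - \<Omega>0" and inner: "pt ` {q+1..p} \<subseteq> \<Omega>0"
    and z: "z \<in> \<Omega> - \<Omega>0"
    and loops: "admissible_loops \<Omega> \<Omega>0 pt q z \<Gamma>1 \<Gamma>2"
begin

abbreviation "Ins1 \<equiv> inside (path_image \<Gamma>1)"
abbreviation "Ins2 \<equiv> inside (path_image \<Gamma>2)"
abbreviation "Out1 \<equiv> outside (path_image \<Gamma>1)"
abbreviation "Out2 \<equiv> outside (path_image \<Gamma>2)"
abbreviation "V \<equiv> \<Omega> - \<Omega>0"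
abbreviation "P \<equiv> node_prod {1..p} pt \<mu>"
abbreviation "A \<equiv> node_prod {1..q} pt \<mu>"
abbreviation "B \<equiv> node_prod {q+1..p} pt \<mu>"

lemma ccw: "ccw_loop \<Gamma>1" "ccw_loop \<Gamma>2"
  using loops by (auto simp: admissible_loops_def)

lemma valid: "valid_path \<Gamma>1" "valid_path \<Gamma>2"
  and closed_path: "pathfinish \<Gamma>1 = pathstart \<Gamma>1" "pathfinish \<Gamma>2 = pathstart \<Gamma>2"
  and winding_inside: "v \<in> Ins1 \<Longrightarrow> winding_number \<Gamma>1 v = 1" "v \<in> Ins2 \<Longrightarrow> winding_number \<Gamma>2 v = 1"
  using ccw by (auto simp: ccw_loop_def)

lemma winding_outside: "v \<in> Out1 \<Longrightarrow> winding_number \<Gamma>1 v = 0" "v \<in> Out2 \<Longrightarrow> winding_number \<Gamma>2 v = 0"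
  using ccw ccw_loop_winding_outside by blast+

lemma images: "path_image \<Gamma>1 \<subseteq> V" "path_image \<Gamma>2 \<subseteq> V" "path_image \<Gamma>2 \<subseteq> Ins1"
  and subs: "\<Omega>0 \<subseteq> Ins1" "\<Omega>0 \<subseteq> Ins2" "Ins1 \<subseteq> \<Omega>" "z \<in> Ins1" "z \<in> Out2"
    "pt ` {1..q} \<subseteq> Ins1" "pt ` {1..q} \<subseteq> Out2"
  using loops by (auto simp: admissible_loops_def)

lemma Ins2_subset_Ins1: "Ins2 \<subseteq> Ins1"
  by (rule inside_subset_inside[OF ccw(1)])
    (use images compact_valid_path_image[OF valid(2)] in auto)

lemma trichotomy:
  "- Ins1 = Out1 \<union> path_image \<Gamma>1" "- Out1 = Ins1 \<union> path_image \<Gamma>1"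
  "- Ins2 = Out2 \<union> path_image \<Gamma>2" "- Out2 = Ins2 \<union> path_image \<Gamma>2"
proof -
  have "- inside S = outside S \<union> S" "- outside S = inside S \<union> S" for S :: "complex set"
    using inside_outside[of S] outside_inside[of S] by blast+
  then show "- Ins1 = Out1 \<union> path_image \<Gamma>1" "- Out1 = Ins1 \<union> path_image \<Gamma>1"
    "- Ins2 = Out2 \<union> path_image \<Gamma>2" "- Out2 = Ins2 \<union> path_image \<Gamma>2"
    by blast+
qed

lemma disjoint_image:
  "v \<in> Ins1 \<Longrightarrow> v \<notin> path_image \<Gamma>1" "v \<in> Out1 \<Longrightarrow> v \<notin> path_image \<Gamma>1"
  "v \<in> Ins2 \<Longrightarrow> v \<notin> path_image \<Gamma>2" "v \<in> Out2 \<Longrightarrow> v \<notin> path_image \<Gamma>2"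
  "v \<in> Ins1 \<Longrightarrow> v \<notin> Out1" "v \<in> Ins2 \<Longrightarrow> v \<notin> Out2"
  using inside_no_overlap outside_no_overlap inside_Int_outside by blast+

lemma open_sets: "open Ins1" "open Ins2" "open Out1" "open Out2"
  using valid by (auto intro!: open_inside open_outside closed_valid_path_image)

lemma open_V: "open V"
  using open_\<Omega> closed_\<Omega>0 by auto

lemma compact_images: "compact (path_image \<Gamma>1)" "compact (path_image \<Gamma>2)"
  using valid compact_valid_path_image by auto

lemma compact_not_outside: "compact (- Out1)" "compact (- Out2)"
proof -
  have "bounded Ins1" "bounded Ins2"
    by (intro bounded_inside compact_imp_bounded compact_images)+
  then have "bounded (- Out1)" "bounded (- Out2)"
    unfolding trichotomy using compact_images compact_imp_bounded by auto
  then show "compact (- Out1)" "compact (- Out2)"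
    using open_sets by (auto simp: compact_eq_bounded_closed closed_Compl)
qed

lemma nodes: "pt ` {1..p} = pt ` {1..q} \<union> pt ` {q+1..p}"
proof -
  have "{1..p} = {1..q} \<union> {q+1..p}" using q by auto
  then show ?thesis by (simp only: image_Un)
qed

lemma nodes_Ins1: "pt ` {1..p} \<subseteq> Ins1"
  using nodes inner subs by auto

lemma A_nz: "w \<notin> pt ` {1..q} \<Longrightarrow> A n w \<noteq> 0"
  and B_nz: "w \<notin> pt ` {q+1..p} \<Longrightarrow> B n w \<noteq> 0"
  and P_nz: "w \<notin> pt ` {1..p} \<Longrightarrow> P n w \<noteq> 0"
  using node_prod_eq_0D by blast+

text \<open>A common domain on which all integrands of the expansion are holomorphic:
  \<open>f\<close> needs \<open>V\<close>, and the only poles are the nodes and \<open>z\<close>.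
  Both loops run inside it.\<close>

definition U :: "complex set" where "U = V - pt ` {1..p} - {z}"

lemma U: "open U" "path_image \<Gamma>1 \<subseteq> U" "path_image \<Gamma>2 \<subseteq> U"
proof -
  show "open U" unfolding U_def
    by (intro open_Diff[OF open_Diff[OF open_V]] finite_imp_closed) auto
  have "x \<in> U" if "x \<in> path_image \<Gamma>1" for x
  proof -
    have "x \<notin> Ins1" using that disjoint_image(1) by blast
    then show ?thesis using that images(1) nodes_Ins1 subs(4) by (auto simp: U_def)
  qed
  then show "path_image \<Gamma>1 \<subseteq> U" by blast
  have "x \<in> U" if "x \<in> path_image \<Gamma>2" for x
  proof -
    have x: "x \<notin> Ins2" "x \<notin> Out2" using that disjoint_image(3,4) by blast+
    have "x \<notin> pt ` {1..p}"
      unfolding nodes using x subs(2,7) inner by blast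
    then show ?thesis using that x images(2) subs(5) by (auto simp: U_def)
  qed
  then show "path_image \<Gamma>2 \<subseteq> U" by blast
qed

lemma U_nz:
  assumes "w \<in> U"
  shows "A n w \<noteq> 0" "B n w \<noteq> 0" "P n w \<noteq> 0" "w - z \<noteq> 0" "j \<in> {1..p} \<Longrightarrow> w - pt j \<noteq> 0"
proof -
  have w: "w \<notin> pt ` {1..p}" "w \<noteq> z" using assms by (auto simp: U_def)
  then have "w \<notin> pt ` {1..q}" "w \<notin> pt ` {q+1..p}" unfolding nodes by blast+
  with w show "A n w \<noteq> 0" "B n w \<noteq> 0" "P n w \<noteq> 0" "w - z \<noteq> 0" "j \<in> {1..p} \<Longrightarrow> w - pt j \<noteq> 0"
    using A_nz B_nz P_nz by auto
qed

lemma integrable: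
  assumes "h holomorphic_on U"
  shows "h contour_integrable_on \<Gamma>1" "h contour_integrable_on \<Gamma>2"
  using assms U valid contour_integrable_holomorphic_simple by blast+

lemma hol_U: "f holomorphic_on U"
  using hol by (rule holomorphic_on_subset) (auto simp: U_def)

text \<open>\<open>z\<close> and all nodes lie inside \<open>\<Gamma>1\<close>, so the poles other
  than \<open>v\<close> share the winding number 1. The value is therefore 0 for every
  \<open>v\<close> inside \<open>\<Gamma>1\<close>.\<close>

lemma contour_integral_outer_kernel:
  assumes v: "v \<notin> path_image \<Gamma>1"
  shows "contour_integral \<Gamma>1 (\<lambda>w. 1 / ((w - z) * P N w) / (v - w)) =
    2 * of_real pi * \<i> * (1 - winding_number \<Gamma>1 v) / ((v - z) * P N v)"
proof -
  obtain as where as: "set as \<subseteq> pt ` {1..p}" "\<And>w. P N w = prod_diff as w"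
    using node_prod_eq_prod_diff[of "{1..p}" pt \<mu> N] by auto
  have "set (z # as) \<subseteq> Ins1" using as nodes_Ins1 subs by auto
  then have "contour_integral \<Gamma>1 (\<lambda>w. 1 / prod_diff (z # as) w / (v - w)) =
    2 * of_real pi * \<i> * (1 - winding_number \<Gamma>1 v) / prod_diff (z # as) v"
    by (intro contour_integral_inverse_prod_diff valid closed_path v)
      (use disjoint_image winding_inside in auto)
  then show ?thesis unfolding as(2) by (simp add: mult.assoc)
qed

text \<open>The inner nodes occur only in the numerator. The remaining poles, \<open>z\<close> and
  the outer nodes, lie outside \<open>\<Gamma>2\<close>, so only the pole at \<open>v\<close>
  contributes, and the value is 0 for every \<open>v\<close> outside
  \<open>\<Gamma>2\<close>.\<close>

lemma contour_integral_inner_kernel: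
  assumes v: "v \<notin> path_image \<Gamma>2" "v \<noteq> z" "v \<notin> pt ` {1..q}"
  shows "contour_integral \<Gamma>2 (\<lambda>w. B N w / A N w / (w - z) / (v - w)) =
    - (2 * of_real pi * \<i> * winding_number \<Gamma>2 v * (B N v / A N v / (v - z)))"
proof (rule contour_integral_Cauchy_kernel[where S = "- insert z (pt ` {1..q})"])
  show "(\<lambda>w. B N w / A N w / (w - z)) holomorphic_on - insert z (pt ` {1..q})"
    by (intro holomorphic_intros A_nz) auto
  show "winding_number \<Gamma>2 w = 0" if "w \<notin> - insert z (pt ` {1..q})" for w
    using that subs winding_outside by auto
  show "path_image \<Gamma>2 \<subseteq> - insert z (pt ` {1..q}) - {v}"
    using subs disjoint_image v by blast
qed (use v valid closed_path in \<open>auto intro!: open_Compl finite_imp_closed\<close>)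

lemma P_0: "P 0 w = 1" "A 0 w = 1" "B 0 w = 1"
  by (auto simp: node_prod_def)

text \<open>At a segment point the two loops have equal winding numbers, both 0 or both 1. The
  weights 1 minus winding number and winding number then add up to 1, and what is left is the
  segment formula for \<open>f z\<close>.\<close>

lemma Cauchy_formula_two_loops:
  "2 * of_real pi * \<i> * f z =
    contour_integral \<Gamma>1 (\<lambda>w. f w / (w - z)) - contour_integral \<Gamma>2 (\<lambda>w. f w / (w - z))"
proof -
  \<comment> \<open>The last set is the closed region between the loops. The points \<open>z\<close>
    and \<open>pt 1\<close>, ..., \<open>pt q\<close> are included so that the segments avoid the
    poles; the inner nodes lie in \<open>\<Omega>0\<close>, which the segments avoid anyway.\<close>
  define K where "K = insert z (pt ` {1..q}) \<union> path_image \<Gamma>1 \<union> path_image \<Gamma>2 \<union> (- Out1 - Ins2)"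
  have K: "compact K" "K \<subseteq> V"
  proof -
    show "compact K"
      unfolding K_def using compact_images compact_not_outside(1) open_sets(2)
      by (intro compact_Un compact_diff) (auto intro: finite_imp_compact)
    have "- Out1 - Ins2 \<subseteq> V" unfolding trichotomy using images(1) subs(2,3) by blast
    then show "K \<subseteq> V" unfolding K_def using images(1,2) z outer by blast
  qed
  obtain n :: nat and a b :: "nat \<Rightarrow> complex" where
    seg: "\<And>i. i < n \<Longrightarrow> closed_segment (a i) (b i) \<subseteq> V - K" and
    rep: "\<And>x. x \<in> K \<Longrightarrow>
      2 * of_real pi * \<i> * f x = (\<Sum>i<n. contour_integral (linepath (a i) (b i)) (\<lambda>v. f v / (v - x)))" and
    loop: "\<And>\<gamma> h S. valid_path \<gamma> \<Longrightarrow> path_image \<gamma> \<subseteq> K \<inter> S \<Longrightarrow> open S \<Longrightarrow> h holomorphic_on S \<Longrightarrow>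
      2 * of_real pi * \<i> * contour_integral \<gamma> (\<lambda>w. f w * h w) =
      (\<Sum>i<n. contour_integral (linepath (a i) (b i)) (\<lambda>v. f v * contour_integral \<gamma> (\<lambda>w. h w / (v - w))))"
    by (rule Cauchy_segments[OF K(1) open_V K(2) hol]) (rule that)
  note kernel = contour_integral_outer_kernel[where N = 0, unfolded P_0 mult_1_right]
    contour_integral_inner_kernel[where N = 0, unfolded P_0 div_by_1]
  have c0: "2 * of_real pi * \<i> \<noteq> (0::complex)" by simp
  have cont: "continuous_on (closed_segment (a i) (b i)) f" if "i < n" for i
    using seg[OF that] hol by (intro holomorphic_on_imp_continuous_on[OF holomorphic_on_subset]) auto
  have S: "(\<lambda>w. 1 / (w - z)) holomorphic_on - {z}" "open (- {z})"
    by (auto intro!: holomorphic_intros)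
  have "2 * of_real pi * \<i> * contour_integral \<Gamma>1 (\<lambda>w. f w * (1 / (w - z))) -
      2 * of_real pi * \<i> * contour_integral \<Gamma>2 (\<lambda>w. f w * (1 / (w - z))) =
    (\<Sum>i<n. contour_integral (linepath (a i) (b i)) (\<lambda>v. f v * contour_integral \<Gamma>1 (\<lambda>w. 1 / (w - z) / (v - w))) -
      contour_integral (linepath (a i) (b i)) (\<lambda>v. f v * contour_integral \<Gamma>2 (\<lambda>w. 1 / (w - z) / (v - w))))"
    unfolding sum_subtractf
    by (intro arg_cong2[where f = "(-)"] loop[OF _ _ S(2,1)] valid) (use U in \<open>auto simp: K_def U_def\<close>)
  also have "\<dots> = (\<Sum>i<n. 2 * of_real pi * \<i> * contour_integral (linepath (a i) (b i)) (\<lambda>v. f v / (v - z)))"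
  proof (intro sum.cong refl)
    fix i assume "i \<in> {..<n}"
    then have i: "i < n" by simp
    define c where "c = 2 * of_real pi * \<i>"
    have v: "v \<notin> path_image \<Gamma>1" "v \<notin> path_image \<Gamma>2" "v \<noteq> z" "v \<notin> pt ` {1..q}" "v \<in> Out1 \<or> v \<in> Ins2"
      if "v \<in> closed_segment (a i) (b i)" for v
      using seg[OF i] that by (auto simp: K_def)
    \<comment> \<open>A point outside \<open>\<Gamma>1\<close> is also outside
      \<open>\<Gamma>2\<close>, and a point inside \<open>\<Gamma>2\<close> is also inside
      \<open>\<Gamma>1\<close>.\<close>
    have w: "winding_number \<Gamma>1 v = winding_number \<Gamma>2 v" if "v \<in> closed_segment (a i) (b i)" for v
      using v(5)[OF that]
    proof
      assume "v \<in> Out1"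
      moreover from this have "v \<notin> Ins1" using disjoint_image(5) by blast
      then have "v \<in> Out2" using Ins2_subset_Ins1 images(3) trichotomy(3) by blast
      ultimately show ?thesis using winding_outside by simp
    next
      assume "v \<in> Ins2"
      then show ?thesis using winding_inside Ins2_subset_Ins1 by auto
    qed
    have cw: "continuous_on (closed_segment (a i) (b i)) (winding_number \<Gamma>1)"
      by (intro continuous_at_imp_continuous_on ballI continuous_at_winding_number valid_path_imp_path valid v(1))
    have "contour_integral (linepath (a i) (b i)) (\<lambda>v. f v * contour_integral \<Gamma>1 (\<lambda>w. 1 / (w - z) / (v - w))) =
      contour_integral (linepath (a i) (b i)) (\<lambda>v. c * (1 - winding_number \<Gamma>1 v) * (f v / (v - z)))"
    proof (rule contour_integral_cong[OF refl])
      fix x assume "x \<in> path_image (linepath (a i) (b i))"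
      then have "x \<notin> path_image \<Gamma>1" using v(1) by simp
      from kernel(1)[OF this]
      show "f x * contour_integral \<Gamma>1 (\<lambda>w. 1 / (w - z) / (x - w)) = c * (1 - winding_number \<Gamma>1 x) * (f x / (x - z))"
        by (simp add: c_def)
    qed
    moreover have "contour_integral (linepath (a i) (b i)) (\<lambda>v. f v * contour_integral \<Gamma>2 (\<lambda>w. 1 / (w - z) / (v - w))) =
      contour_integral (linepath (a i) (b i)) (\<lambda>v. - c * winding_number \<Gamma>1 v * (f v / (v - z)))"
    proof (rule contour_integral_cong[OF refl])
      fix x assume "x \<in> path_image (linepath (a i) (b i))"
      then have x: "x \<in> closed_segment (a i) (b i)" by simp
      from kernel(2)[OF v(2,3,4)[OF x]] w[OF x]
      show "f x * contour_integral \<Gamma>2 (\<lambda>w. 1 / (w - z) / (x - w)) = - c * winding_number \<Gamma>1 x * (f x / (x - z))"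
        by (simp add: c_def)
    qed
    moreover have "contour_integral (linepath (a i) (b i)) (\<lambda>v. c * (1 - winding_number \<Gamma>1 v) * (f v / (v - z))) -
      contour_integral (linepath (a i) (b i)) (\<lambda>v. - c * winding_number \<Gamma>1 v * (f v / (v - z))) =
      contour_integral (linepath (a i) (b i)) (\<lambda>v. c * (f v / (v - z)))"
    proof -
      have g: "continuous_on (closed_segment (a i) (b i)) (\<lambda>v. f v / (v - z))"
        using v(3) by (intro continuous_on_divide cont[OF i] continuous_on_diff continuous_on_id continuous_on_const) auto
      have "contour_integral (linepath (a i) (b i)) (\<lambda>v. c * (1 - winding_number \<Gamma>1 v) * (f v / (v - z))) -
          contour_integral (linepath (a i) (b i)) (\<lambda>v. - c * winding_number \<Gamma>1 v * (f v / (v - z))) =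
        contour_integral (linepath (a i) (b i)) (\<lambda>v. c * (1 - winding_number \<Gamma>1 v) * (f v / (v - z)) -
          - c * winding_number \<Gamma>1 v * (f v / (v - z)))"
        by (intro contour_integral_diff[symmetric] contour_integrable_continuous_linepath
            continuous_on_mult continuous_on_diff continuous_on_const cw g)
      also have "(\<lambda>v. c * (1 - winding_number \<Gamma>1 v) * (f v / (v - z)) -
          - c * winding_number \<Gamma>1 v * (f v / (v - z))) = (\<lambda>v. c * (f v / (v - z)))"
        by (simp add: algebra_simps)
      finally show ?thesis .
    qed
    moreover have "\<dots> = c * contour_integral (linepath (a i) (b i)) (\<lambda>v. f v / (v - z))"
      using v(3) cont[OF i]
      by (intro contour_integral_lmul contour_integrable_continuous_linepath continuous_intros) auto
    ultimately show "contour_integral (linepath (a i) (b i)) (\<lambda>v. f v * contour_integral \<Gamma>1 (\<lambda>w. 1 / (w - z) / (v - w))) -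
      contour_integral (linepath (a i) (b i)) (\<lambda>v. f v * contour_integral \<Gamma>2 (\<lambda>w. 1 / (w - z) / (v - w))) =
      2 * of_real pi * \<i> * contour_integral (linepath (a i) (b i)) (\<lambda>v. f v / (v - z))"
      by (simp add: c_def)
  qed
  \<comment> \<open>One factor 2 pi i comes from the segment formula, the other from the kernels;
    one of them cancels at the end.\<close>
  also have "\<dots> = 2 * of_real pi * \<i> * (2 * of_real pi * \<i> * f z)"
    unfolding sum_distrib_left[symmetric] by (subst rep) (auto simp: K_def)
  finally show ?thesis using c0 unfolding right_diff_distrib[symmetric] mult_cancel_left by simp
qed

section \<open>Telescoping of the remainder\<close>

definition I1 :: "nat \<Rightarrow> complex" where
  "I1 n = contour_integral \<Gamma>1 (\<lambda>w. f w / ((w - z) * P n w))"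

definition I2 :: "nat \<Rightarrow> complex" where
  "I2 n = contour_integral \<Gamma>2 (\<lambda>w. B n w / A n w * (f w / (w - z)))"

lemma remainder_eq:
  "remainder f \<Gamma>1 \<Gamma>2 pt \<mu> p q N z = 1 / (2 * of_real pi * \<i>) * (I1 N * P N z - I2 N * (A N z / B N z))"
  by (simp add: remainder_def I1_def I2_def right_diff_distrib)

lemma remainder_0: "remainder f \<Gamma>1 \<Gamma>2 pt \<mu> p q 0 z = f z"
  using Cauchy_formula_two_loops
  by (simp only: remainder_eq I1_def I2_def P_0) (simp add: field_simps)

lemma B_z: "B n z \<noteq> 0"
  using B_nz inner z by blast

text \<open>The three shapes of the integrand for \<open>q_poly\<close>, \<open>t1_poly\<close> and
  \<open>t2_poly\<close>. In the third one \<open>Y\<close> is also a factor of the numerator, so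
  that the subtracted term loses a power instead of gaining one.\<close>

lemma kernel_difference:
  fixes F X Y d y b :: complex
  assumes "X \<noteq> 0" "Y \<noteq> 0" "d \<noteq> 0"
  shows "F / X * (1 - y / Y) / d = F / (d * X) - y * (F / (d * (Y * X)))"
    and "b / X * F * (1 - y / Y) / d = b / X * (F / d) - y * (b / (Y * X) * (F / d))"
    and "(Y * b) / X * F * (1 - y / Y) / d = (Y * b) / X * (F / d) - y * (b / X * (F / d))"
  using assms by (simp_all add: field_simps)

text \<open>The interpolated kernel carries the factor 1 - P(z)/P(w), which splits the integral into
  two consecutive values of \<open>I1\<close>.\<close>

lemma poly_q_poly:
  "poly (q_poly f \<Gamma>1 pt \<mu> p n) z = 1 / (2 * of_real pi * \<i>) * (I1 n - P 1 z * I1 (Suc n))"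
proof -
  have U1: "w \<in> path_image \<Gamma>1 \<Longrightarrow> w \<in> U" for w using U by auto
  have "poly (q_poly f \<Gamma>1 pt \<mu> p n) z = 1 / (2 * of_real pi * \<i>) *
     contour_integral \<Gamma>1 (\<lambda>w. f w / P n w * (1 - P 1 z / P 1 w) / (w - z))"
    unfolding q_poly_def coeff_a_def
  proof (subst contour_integral_hermite_poly[symmetric])
    show "(\<lambda>w. f w / P n w / (w - pt j) ^ (l + 1)) contour_integrable_on \<Gamma>1" if "j \<in> {1..p}" for j l
      by (intro integrable holomorphic_intros hol_U) (use U_nz that in auto)
  qed (use mult inj valid U1 in \<open>auto simp: mult_ac U_def\<close>)
  also have "contour_integral \<Gamma>1 (\<lambda>w. f w / P n w * (1 - P 1 z / P 1 w) / (w - z)) =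
    contour_integral \<Gamma>1 (\<lambda>w. f w / ((w - z) * P n w) - P 1 z * (f w / ((w - z) * P (Suc n) w)))"
  proof (rule contour_integral_cong[OF refl])
    fix w assume "w \<in> path_image \<Gamma>1"
    note nz = U_nz[OF U1[OF this]]
    have "P (Suc n) w = P 1 w * P n w" by (subst (1 3) node_prod_power) simp
    then show "f w / P n w * (1 - P 1 z / P 1 w) / (w - z) =
      f w / ((w - z) * P n w) - P 1 z * (f w / ((w - z) * P (Suc n) w))"
      using kernel_difference(1)[OF nz(3)[of n] nz(3)[of 1] nz(4)] by simp
  qed
  also have "\<dots> = I1 n - P 1 z * I1 (Suc n)"
    unfolding I1_def
    by (subst contour_integral_diff, (intro integrable holomorphic_intros hol_U; use U_nz in simp)+)
      (subst contour_integral_lmul, (intro integrable holomorphic_intros hol_U; use U_nz in simp)+, rule refl)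
  finally show ?thesis .
qed

text \<open>The half step between \<open>I2 n\<close> and \<open>I2 (Suc n)\<close>: the power of A
  has been raised already, that of B not yet. It enters both \<open>t1_poly\<close> and
  \<open>t2_poly\<close> and cancels in their sum.\<close>

definition J :: "nat \<Rightarrow> complex" where
  "J n = contour_integral \<Gamma>2 (\<lambda>w. B n w / A (Suc n) w * (f w / (w - z)))"

lemma poly_t1_poly:
  "poly (t1_poly f \<Gamma>2 pt \<mu> p q n) z = - (1 / (2 * of_real pi * \<i>) * (I2 n - A 1 z * J n))"
proof -
  have U2: "w \<in> path_image \<Gamma>2 \<Longrightarrow> w \<in> U" for w using U by auto
  have inj': "inj_on pt {1..q}" using inj q by (auto intro: inj_on_subset)
  have disj: "pt ` {1..q} \<inter> path_image \<Gamma>2 = {}" "z \<notin> path_image \<Gamma>2"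
    using U2 nodes unfolding U_def by blast+
  have "poly (t1_poly f \<Gamma>2 pt \<mu> p q n) z = - (1 / (2 * of_real pi * \<i>) *
     contour_integral \<Gamma>2 (\<lambda>w. B n w / A n w * f w * (1 - A 1 z / A 1 w) / (w - z)))"
    unfolding t1_poly_def coeff_b_def poly_minus
  proof (subst contour_integral_hermite_poly[symmetric])
    show "(\<lambda>w. B n w / A n w * f w / (w - pt j) ^ (l + 1)) contour_integrable_on \<Gamma>2" if "j \<in> {1..q}" for j l
      by (intro integrable holomorphic_intros hol_U) (use U_nz that q in auto)
  qed (use mult inj' valid disj q in \<open>auto simp: mult_ac\<close>)
  also have "contour_integral \<Gamma>2 (\<lambda>w. B n w / A n w * f w * (1 - A 1 z / A 1 w) / (w - z)) =
    contour_integral \<Gamma>2 (\<lambda>w. B n w / A n w * (f w / (w - z)) - A 1 z * (B n w / A (Suc n) w * (f w / (w - z))))"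
  proof (rule contour_integral_cong[OF refl])
    fix w assume "w \<in> path_image \<Gamma>2"
    note nz = U_nz[OF U2[OF this]]
    have "A (Suc n) w = A 1 w * A n w" by (subst (1 3) node_prod_power) simp
    then show "B n w / A n w * f w * (1 - A 1 z / A 1 w) / (w - z) =
      B n w / A n w * (f w / (w - z)) - A 1 z * (B n w / A (Suc n) w * (f w / (w - z)))"
      using kernel_difference(2)[OF nz(1)[of n] nz(1)[of 1] nz(4)] by simp
  qed
  also have "\<dots> = I2 n - A 1 z * J n"
    unfolding I2_def J_def
    by (subst contour_integral_diff, (intro integrable holomorphic_intros hol_U; use U_nz in simp)+)
      (subst contour_integral_lmul, (intro integrable holomorphic_intros hol_U; use U_nz in simp)+, rule refl)
  finally show ?thesis .
qed

lemma poly_t2_poly: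
  "poly (t2_poly f \<Gamma>2 pt \<mu> p q n) z = 1 / (2 * of_real pi * \<i>) * (I2 (Suc n) - B 1 z * J n)"
proof -
  have U2: "w \<in> path_image \<Gamma>2 \<Longrightarrow> w \<in> U" for w using U by auto
  have inj': "inj_on pt {q+1..p}" using inj q by (auto intro: inj_on_subset)
  have disj: "pt ` {q+1..p} \<inter> path_image \<Gamma>2 = {}" "z \<notin> path_image \<Gamma>2"
    using U2 nodes unfolding U_def by blast+
  have "poly (t2_poly f \<Gamma>2 pt \<mu> p q n) z = 1 / (2 * of_real pi * \<i>) *
     contour_integral \<Gamma>2 (\<lambda>w. B (n + 1) w / A (n + 1) w * f w * (1 - B 1 z / B 1 w) / (w - z))"
    unfolding t2_poly_def coeff_c_def
  proof (subst contour_integral_hermite_poly[symmetric])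
    show "(\<lambda>w. B (n + 1) w / A (n + 1) w * f w / (w - pt j) ^ (l + 1)) contour_integrable_on \<Gamma>2" if "j \<in> {q+1..p}" for j l
      by (intro integrable holomorphic_intros hol_U) (use U_nz that q in auto)
  qed (use mult inj' valid disj q in \<open>auto simp: mult_ac\<close>)
  also have "contour_integral \<Gamma>2 (\<lambda>w. B (n + 1) w / A (n + 1) w * f w * (1 - B 1 z / B 1 w) / (w - z)) =
    contour_integral \<Gamma>2 (\<lambda>w. B (Suc n) w / A (Suc n) w * (f w / (w - z)) - B 1 z * (B n w / A (Suc n) w * (f w / (w - z))))"
  proof (rule contour_integral_cong[OF refl])
    fix w assume "w \<in> path_image \<Gamma>2"
    note nz = U_nz[OF U2[OF this]]
    have "B (Suc n) w = B 1 w * B n w" by (subst (1 3) node_prod_power) simp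
    then show "B (n + 1) w / A (n + 1) w * f w * (1 - B 1 z / B 1 w) / (w - z) =
      B (Suc n) w / A (Suc n) w * (f w / (w - z)) - B 1 z * (B n w / A (Suc n) w * (f w / (w - z)))"
      using kernel_difference(3)[OF nz(1)[of "Suc n"] nz(2)[of 1] nz(4)] by simp
  qed
  also have "\<dots> = I2 (Suc n) - B 1 z * J n"
    unfolding I2_def J_def
    by (subst contour_integral_diff, (intro integrable holomorphic_intros hol_U; use U_nz in simp)+)
      (subst contour_integral_lmul, (intro integrable holomorphic_intros hol_U; use U_nz in simp)+, rule refl)
  finally show ?thesis .
qed

text \<open>The q-term accounts for the change of the \<open>I1\<close> part. The t1-term leads from
  \<open>I2 n\<close> to \<open>J n\<close>, and the t2-term from \<open>J n\<close> to
  \<open>I2 (Suc n)\<close>.\<close>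

lemma expansion_step:
  "remainder f \<Gamma>1 \<Gamma>2 pt \<mu> p q n z =
     poly (q_poly f \<Gamma>1 pt \<mu> p n) z * P n z
   + poly (t1_poly f \<Gamma>2 pt \<mu> p q n) z * (A n z / B n z)
   + poly (t2_poly f \<Gamma>2 pt \<mu> p q n) z * (A (n + 1) z / B (n + 1) z)
   + remainder f \<Gamma>1 \<Gamma>2 pt \<mu> p q (Suc n) z"
proof -
  have s: "P (Suc n) z = P 1 z * P n z" "A (Suc n) z = A 1 z * A n z" "B (Suc n) z = B 1 z * B n z"
    by (subst (1 3) node_prod_power, simp)+
  then have s': "A (n + 1) z = A 1 z * A n z" "B (n + 1) z = B 1 z * B n z"
    by simp_all
  have nz: "B 1 z \<noteq> 0" "B n z \<noteq> 0" by (rule B_z)+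
  \<comment> \<open>This relation between consecutive quotients makes the two contributions of
    \<open>J n\<close> cancel.\<close>
  have Q: "B 1 z * (A (n + 1) z / B (n + 1) z) = A 1 z * (A n z / B n z)"
    using nz by (simp add: s' del: One_nat_def)
  have alg: "c * (i1 * p0 - i2 * x) = c * (i1 - p1 * i1') * p0 + - (c * (i2 - a1 * j)) * x
      + c * (i2' - b1 * j) * y + c * (i1' * (p1 * p0) - i2' * y)"
    if "b1 * y = a1 * x" for c i1 i1' i2 i2' j p0 p1 a1 b1 x y :: complex
    using that by algebra
  show ?thesis
    unfolding remainder_eq poly_q_poly poly_t1_poly poly_t2_poly Suc_eq_plus1 s(1)[unfolded Suc_eq_plus1]
    by (rule alg[OF Q])
qed

lemma expansion:
  "f z = (\<Sum>n<N. poly (q_poly f \<Gamma>1 pt \<mu> p n) z * P n z)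
      + (\<Sum>n<N. poly (t1_poly f \<Gamma>2 pt \<mu> p q n) z * (A n z / B n z))
      + (\<Sum>n<N. poly (t2_poly f \<Gamma>2 pt \<mu> p q n) z * (A (n + 1) z / B (n + 1) z))
      + remainder f \<Gamma>1 \<Gamma>2 pt \<mu> p q N z"
proof (induction N)
  case 0
  show ?case by (simp add: remainder_0)
next
  case (Suc N)
  then show ?case unfolding expansion_step[of N] by simp
qed

subsection \<open>Decay of the remainder\<close>

lemma continuous_f: "closed_segment x y \<subseteq> V \<Longrightarrow> continuous_on (closed_segment x y) f"
  using hol by (intro holomorphic_on_imp_continuous_on[OF holomorphic_on_subset])

lemma continuous_winding:
  "closed_segment x y \<inter> path_image \<Gamma>1 = {} \<Longrightarrow> continuous_on (closed_segment x y) (winding_number \<Gamma>1)"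
  "closed_segment x y \<inter> path_image \<Gamma>2 = {} \<Longrightarrow> continuous_on (closed_segment x y) (winding_number \<Gamma>2)"
  by (intro continuous_at_imp_continuous_on ballI continuous_at_winding_number valid_path_imp_path valid; blast)+

lemma continuous_node_prod: "continuous_on S (node_prod K pt \<mu> n)"
  by (intro holomorphic_on_imp_continuous_on holomorphic_intros)

lemma outer_integral_tendsto_0:
  assumes r1: "ereal (node_abs {1..p} pt \<mu> z) < radius1 \<Omega> pt \<mu> p"
  shows "(\<lambda>N. I1 N * P N z) \<longlonglongrightarrow> 0"
proof -
  obtain \<rho> where \<rho>: "node_abs {1..p} pt \<mu> z < \<rho>" "ereal \<rho> < radius1 \<Omega> pt \<mu> p"
    using ereal_dense2[OF r1] by auto
  \<comment> \<open>The sublevel set is compact because P is a nonconstant polynomial. It lies in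
    \<open>\<Omega>\<close> since \<open>\<rho>\<close> is below r1, and its part off
    \<open>Ins1\<close> misses \<open>\<Omega>0\<close>. Adding \<open>z\<close> and the outer nodes
    keeps the segments off the poles.\<close>
  define K where "K = insert z (pt ` {1..q}) \<union> path_image \<Gamma>1 \<union> ({w. node_abs {1..p} pt \<mu> w \<le> \<rho>} \<inter> - Ins1)"
  have "{1..p} \<noteq> {}" using p by simp
  then have "compact {w. node_abs {1..p} pt \<mu> w \<le> \<rho>}"
    unfolding compact_eq_bounded_closed using mult
    by (intro conjI bounded_node_abs_le closed_Collect_le continuous_on_node_abs continuous_on_const) auto
  then have "compact ({w. node_abs {1..p} pt \<mu> w \<le> \<rho>} \<inter> - Ins1)"
    using open_sets(1) by (intro compact_Int_closed closed_Compl)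
  moreover have "compact (insert z (pt ` {1..q}))" by (intro finite_imp_compact) simp
  ultimately have K: "compact K"
    unfolding K_def by (intro compact_Un compact_images)
  have KV: "K \<subseteq> V"
  proof -
    have "w \<in> V" if w: "node_abs {1..p} pt \<mu> w \<le> \<rho>" "w \<notin> Ins1" for w
    proof -
      have "w \<in> \<Omega>"
      proof (rule ccontr)
        assume "w \<notin> \<Omega>"
        then have "radius1 \<Omega> pt \<mu> p \<le> ereal (node_abs {1..p} pt \<mu> w)"
          unfolding radius1_def by (intro INF_lower) auto
        also have "\<dots> \<le> ereal \<rho>" using w by simp
        finally show False using \<rho>(2) by simp
      qed
      then show ?thesis using w subs(1) by blast
    qed
    then show ?thesis unfolding K_def using images(1) z outer by blast
  qed
  obtain n :: nat and a b :: "nat \<Rightarrow> complex" where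
    seg: "\<And>i. i < n \<Longrightarrow> closed_segment (a i) (b i) \<subseteq> V - K" and
    rep: "\<And>x. x \<in> K \<Longrightarrow>
      2 * of_real pi * \<i> * f x = (\<Sum>i<n. contour_integral (linepath (a i) (b i)) (\<lambda>v. f v / (v - x)))" and
    loop: "\<And>\<gamma> h S. valid_path \<gamma> \<Longrightarrow> path_image \<gamma> \<subseteq> K \<inter> S \<Longrightarrow> open S \<Longrightarrow> h holomorphic_on S \<Longrightarrow>
      2 * of_real pi * \<i> * contour_integral \<gamma> (\<lambda>w. f w * h w) =
      (\<Sum>i<n. contour_integral (linepath (a i) (b i)) (\<lambda>v. f v * contour_integral \<gamma> (\<lambda>w. h w / (v - w))))"
    by (rule Cauchy_segments[OF K open_V KV hol]) (rule that)
  define c where "c = 2 * of_real pi * \<i>"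
  have c: "c \<noteq> 0" by (simp add: c_def)
  \<comment> \<open>The whole dependence on N is the N-th power of the quotient \<open>H\<close>;
    \<open>G\<close> collects the rest, including the weight that vanishes inside
    \<open>\<Gamma>1\<close>.\<close>
  define G where "G = (\<lambda>v. c * f v * (1 - winding_number \<Gamma>1 v) / (v - z))"
  define H where "H = (\<lambda>v. P 1 z / P 1 v)"
  have v: "v \<notin> path_image \<Gamma>1" "v - z \<noteq> 0" "P N v \<noteq> 0"
      "v \<in> Ins1 \<or> \<rho> < node_abs {1..p} pt \<mu> v"
    if i: "i < n" and v: "v \<in> closed_segment (a i) (b i)" for i v N
  proof -
    have *: "v \<in> V" "v \<notin> K" using seg[OF i] v by auto
    then show "v \<notin> path_image \<Gamma>1" "v - z \<noteq> 0" "v \<in> Ins1 \<or> \<rho> < node_abs {1..p} pt \<mu> v"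
      by (auto simp: K_def)
    have "v \<notin> pt ` {1..p}"
      unfolding nodes using * inner by (auto simp: K_def)
    then show "P N v \<noteq> 0" by (rule P_nz)
  qed
  have G: "continuous_on (closed_segment (a i) (b i)) G" if "i < n" for i
    unfolding G_def using v[OF that] seg[OF that]
    by (intro continuous_on_divide continuous_on_mult continuous_on_diff continuous_on_id continuous_on_const
        continuous_f continuous_winding) auto
  have H: "continuous_on (closed_segment (a i) (b i)) H" if "i < n" for i
    unfolding H_def using v(3)[OF that]
    by (intro continuous_on_divide continuous_on_const continuous_node_prod) blast
  have eq: "c * (I1 N * P N z) = (\<Sum>i<n. contour_integral (linepath (a i) (b i)) (\<lambda>v. G v * H v ^ N))" for N
  proof -
    have "c * I1 N = c * contour_integral \<Gamma>1 (\<lambda>w. f w * (1 / ((w - z) * P N w)))"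
      by (simp add: I1_def)
    also have "\<dots> = (\<Sum>i<n. contour_integral (linepath (a i) (b i))
        (\<lambda>v. f v * contour_integral \<Gamma>1 (\<lambda>w. 1 / ((w - z) * P N w) / (v - w))))"
      unfolding c_def
    proof (rule loop[where S = U])
      show "(\<lambda>w. 1 / ((w - z) * P N w)) holomorphic_on U"
        by (intro holomorphic_intros) (use U_nz in auto)
    qed (use U valid in \<open>auto simp: K_def\<close>)
    finally have "c * (I1 N * P N z) = (\<Sum>i<n. contour_integral (linepath (a i) (b i))
        (\<lambda>v. f v * contour_integral \<Gamma>1 (\<lambda>w. 1 / ((w - z) * P N w) / (v - w))) * P N z)"
      by (simp add: sum_distrib_right mult.assoc[symmetric])
    also have "\<dots> = (\<Sum>i<n. contour_integral (linepath (a i) (b i)) (\<lambda>v. G v * H v ^ N))"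
    proof (intro sum.cong refl)
      fix i assume "i \<in> {..<n}"
      then have i: "i < n" by simp
      have "contour_integral (linepath (a i) (b i))
          (\<lambda>v. f v * contour_integral \<Gamma>1 (\<lambda>w. 1 / ((w - z) * P N w) / (v - w))) =
        contour_integral (linepath (a i) (b i)) (\<lambda>v. G v / P N v)"
      proof (rule contour_integral_cong[OF refl])
        fix x assume "x \<in> path_image (linepath (a i) (b i))"
        then have "x \<notin> path_image \<Gamma>1" using v(1)[OF i] by simp
        from contour_integral_outer_kernel[OF this, of N]
        show "f x * contour_integral \<Gamma>1 (\<lambda>w. 1 / ((w - z) * P N w) / (x - w)) = G x / P N x"
          by (simp add: G_def c_def)
      qed
      moreover have "(\<lambda>v. G v / P N v) contour_integrable_on linepath (a i) (b i)"
        using v(3)[OF i]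
        by (intro contour_integrable_continuous_linepath continuous_on_divide G[OF i] continuous_node_prod) blast
      then have "contour_integral (linepath (a i) (b i)) (\<lambda>v. G v / P N v * P N z) =
          contour_integral (linepath (a i) (b i)) (\<lambda>v. G v / P N v) * P N z"
        by (rule contour_integral_rmul)
      moreover have "(\<lambda>v. G v / P N v * P N z) = (\<lambda>v. G v * H v ^ N)"
        unfolding H_def by (subst (1 2) node_prod_power) (simp add: power_divide)
      ultimately show "contour_integral (linepath (a i) (b i))
          (\<lambda>v. f v * contour_integral \<Gamma>1 (\<lambda>w. 1 / ((w - z) * P N w) / (v - w))) * P N z =
        contour_integral (linepath (a i) (b i)) (\<lambda>v. G v * H v ^ N)"
        by simp
    qed
    finally show ?thesis .
  qed
  have nonneg: "0 \<le> node_abs {1..p} pt \<mu> z" by (simp add: flip: norm_node_prod)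
  have "(\<lambda>N. \<Sum>i<n. contour_integral (linepath (a i) (b i)) (\<lambda>v. G v * H v ^ N)) \<longlonglongrightarrow> 0"
  \<comment> \<open>A segment point misses \<open>K\<close>: either it is inside
    \<open>\<Gamma>1\<close>, where \<open>G\<close> is 0, or |P| exceeds \<open>\<rho>\<close>
    there.\<close>
  proof (rule tendsto_sum_contour_integral_power[OF G H, where \<theta> = "node_abs {1..p} pt \<mu> z / \<rho>"])
    fix i v assume i: "i < n" "v \<in> closed_segment (a i) (b i)"
    show "G v = 0 \<or> norm (H v) \<le> node_abs {1..p} pt \<mu> z / \<rho>"
      using v(4)[OF i]
    proof
      assume "v \<in> Ins1"
      then show ?thesis using winding_inside(1) by (simp add: G_def)
    next
      assume "\<rho> < node_abs {1..p} pt \<mu> v"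
      then show ?thesis
        unfolding H_def norm_divide norm_node_prod using \<rho> nonneg by (intro disjI2 divide_left_mono) auto
    qed
  qed (use \<rho> nonneg in auto)
  then have "(\<lambda>N. c * (I1 N * P N z)) \<longlonglongrightarrow> 0" unfolding eq .
  from tendsto_mult[OF tendsto_const[of "1 / c"] this] show ?thesis using c by simp
qed

lemma inner_integral_tendsto_0:
  assumes r2: "ereal (node_abs {1..q} pt \<mu> z) < radius2 \<Omega>0 pt \<mu> p q * ereal (node_abs {q+1..p} pt \<mu> z)"
  shows "(\<lambda>N. I2 N * (A N z / B N z)) \<longlonglongrightarrow> 0"
proof -
  define \<alpha> where "\<alpha> = node_abs {1..q} pt \<mu> z"
  define \<beta> where "\<beta> = node_abs {q+1..p} pt \<mu> z"
  have \<alpha>: "0 \<le> \<alpha>" unfolding \<alpha>_def by (simp flip: norm_node_prod)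
  have \<beta>: "0 < \<beta>" unfolding \<beta>_def using B_z[of 1] by (simp flip: norm_node_prod)
  obtain \<rho> where \<rho>: "\<alpha> / \<beta> < \<rho>" "ereal \<rho> < radius2 \<Omega>0 pt \<mu> p q"
  proof -
    \<comment> \<open>Division by \<open>\<beta>\<close> is legitimate because \<open>z\<close> is
      not in \<open>\<Omega>0\<close> and hence no inner node. The case distinction includes an
      infinite r2.\<close>
    have "ereal (\<alpha> / \<beta>) < radius2 \<Omega>0 pt \<mu> p q"
      using r2 \<beta> unfolding \<alpha>_def[symmetric] \<beta>_def[symmetric]
      by (cases "radius2 \<Omega>0 pt \<mu> p q") (auto simp: field_simps)
    from ereal_dense2[OF this] show ?thesis using that by auto
  qed
  have \<rho>0: "0 < \<rho>" using \<rho>(1) \<alpha> \<beta> by (meson divide_nonneg_pos le_less_trans)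
  \<comment> \<open>The sublevel set of the quotient, written without division: this form is visibly
    closed and makes sense at the inner nodes. Compactness comes from the intersection with
    \<open>- Out2\<close>, since \<open>L\<close> may be unbounded.\<close>
  define L where "L = {w. node_abs {1..q} pt \<mu> w \<le> \<rho> * node_abs {q+1..p} pt \<mu> w}"
  define K where "K = insert z (pt ` {1..q}) \<union> path_image \<Gamma>2 \<union> (- Out2 \<inter> L)"
  have "closed L"
    unfolding L_def by (intro closed_Collect_le continuous_on_node_abs continuous_on_mult continuous_on_const)
  then have "compact (- Out2 \<inter> L)"
    by (intro compact_Int_closed compact_not_outside)
  moreover have "compact (insert z (pt ` {1..q}))" by (intro finite_imp_compact) simp
  ultimately have K: "compact K"
    unfolding K_def by (intro compact_Un compact_images)
  have KV: "K \<subseteq> V"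
  proof -
    have "w \<in> V" if w: "w \<in> L" "w \<in> - Out2" for w
    proof -
      have "w \<in> \<Omega>"
        using w(2) Ins2_subset_Ins1 subs(3) images(2) unfolding trichotomy by blast
      moreover have "w \<notin> \<Omega>0"
      proof
        \<comment> \<open>Outer nodes are not in \<open>\<Omega>0\<close>, so the left side of the
          inequality defining \<open>L\<close> is positive at \<open>w\<close>. This excludes the
          inner nodes, where the right side is 0, in accordance with the value \<infinity> there in
          \<open>radius2\<close>; at any other point \<open>\<rho>\<close> would be at least
          r2.\<close>
        assume w0: "w \<in> \<Omega>0"
        then have wA: "w \<notin> pt ` {1..q}" using outer by blast
        then have "0 < node_abs {1..q} pt \<mu> w" using A_nz[of w 1] by (simp flip: norm_node_prod)
        then have "0 < \<rho> * node_abs {q+1..p} pt \<mu> w" using w(1) by (simp add: L_def)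
        then have pos: "0 < node_abs {q+1..p} pt \<mu> w" using \<rho>0 zero_less_mult_pos by blast
        have "B 1 w = 0" if "w \<in> pt ` {q+1..p}"
        proof -
          obtain k where k: "k \<in> {q+1..p}" "w = pt k" using \<open>w \<in> pt ` {q+1..p}\<close> by blast
          moreover have "\<mu> k \<ge> 1" using k mult[of k] by simp
          ultimately show ?thesis
            unfolding node_prod_def by (intro prod_zero bexI[of _ k]) auto
        qed
        then have "w \<notin> pt ` {q+1..p}" using pos norm_node_prod[of "{q+1..p}" pt \<mu> w] by force
        then have "radius2 \<Omega>0 pt \<mu> p q \<le> ereal (node_abs {1..q} pt \<mu> w * inverse (node_abs {q+1..p} pt \<mu> w))"
          unfolding radius2_def using w0 by (intro INF_lower2[of w]) auto
        also have "\<dots> \<le> ereal \<rho>"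
          using w(1) pos by (simp add: L_def field_simps)
        finally show False using \<rho>(2) by simp
      qed
      ultimately show ?thesis by blast
    qed
    then show ?thesis unfolding K_def using images(2) z outer by blast
  qed
  obtain n :: nat and a b :: "nat \<Rightarrow> complex" where
    seg: "\<And>i. i < n \<Longrightarrow> closed_segment (a i) (b i) \<subseteq> V - K" and
    rep: "\<And>x. x \<in> K \<Longrightarrow>
      2 * of_real pi * \<i> * f x = (\<Sum>i<n. contour_integral (linepath (a i) (b i)) (\<lambda>v. f v / (v - x)))" and
    loop: "\<And>\<gamma> h S. valid_path \<gamma> \<Longrightarrow> path_image \<gamma> \<subseteq> K \<inter> S \<Longrightarrow> open S \<Longrightarrow> h holomorphic_on S \<Longrightarrow>
      2 * of_real pi * \<i> * contour_integral \<gamma> (\<lambda>w. f w * h w) =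
      (\<Sum>i<n. contour_integral (linepath (a i) (b i)) (\<lambda>v. f v * contour_integral \<gamma> (\<lambda>w. h w / (v - w))))"
    by (rule Cauchy_segments[OF K open_V KV hol]) (rule that)
  define c where "c = 2 * of_real pi * \<i>"
  have c: "c \<noteq> 0" by (simp add: c_def)
  \<comment> \<open>The weight is now minus the winding number around \<open>\<Gamma>2\<close>, so
    \<open>G\<close> vanishes outside \<open>\<Gamma>2\<close>; inside, a segment point misses
    \<open>L\<close>, which bounds the first quotient in \<open>H\<close> by
    1/\<open>\<rho>\<close>.\<close>
  define G where "G = (\<lambda>v. - c * f v * winding_number \<Gamma>2 v / (v - z))"
  define H where "H = (\<lambda>v. B 1 v / A 1 v * (A 1 z / B 1 z))"
  have v: "v \<notin> path_image \<Gamma>2" "v - z \<noteq> 0" "v \<notin> pt ` {1..q}" "A N v \<noteq> 0" "B N v \<noteq> 0"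
      "v \<in> Out2 \<or> \<rho> * node_abs {q+1..p} pt \<mu> v < node_abs {1..q} pt \<mu> v"
    if i: "i < n" and v: "v \<in> closed_segment (a i) (b i)" for i v N
  proof -
    have *: "v \<in> V" "v \<notin> K" using seg[OF i] v by auto
    then show "v \<notin> path_image \<Gamma>2" "v - z \<noteq> 0" "v \<in> Out2 \<or> \<rho> * node_abs {q+1..p} pt \<mu> v < node_abs {1..q} pt \<mu> v"
      by (auto simp: K_def L_def)
    show nA: "v \<notin> pt ` {1..q}" using * by (auto simp: K_def)
    have "v \<notin> pt ` {q+1..p}" using * inner by blast
    with nA show "A N v \<noteq> 0" "B N v \<noteq> 0" using A_nz B_nz by blast+
  qed
  have G: "continuous_on (closed_segment (a i) (b i)) G" if "i < n" for i
    unfolding G_def using v[OF that] seg[OF that]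
    by (intro continuous_on_divide continuous_on_mult continuous_on_diff continuous_on_id continuous_on_const
        continuous_f continuous_winding) auto
  have E: "continuous_on (closed_segment (a i) (b i)) (\<lambda>v. B N v / A N v)" if "i < n" for i N
    using v(4)[OF that] by (intro continuous_on_divide continuous_node_prod) blast
  have H: "continuous_on (closed_segment (a i) (b i)) H" if "i < n" for i
    unfolding H_def by (intro continuous_on_mult continuous_on_const E that)
  have eq: "c * (I2 N * (A N z / B N z)) = (\<Sum>i<n. contour_integral (linepath (a i) (b i)) (\<lambda>v. G v * H v ^ N))" for N
  proof -
    have "c * I2 N = c * contour_integral \<Gamma>2 (\<lambda>w. f w * (B N w / A N w / (w - z)))"
      by (simp add: I2_def mult_ac)
    also have "\<dots> = (\<Sum>i<n. contour_integral (linepath (a i) (b i))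
        (\<lambda>v. f v * contour_integral \<Gamma>2 (\<lambda>w. B N w / A N w / (w - z) / (v - w))))"
      unfolding c_def
    proof (rule loop[where S = U])
      show "(\<lambda>w. B N w / A N w / (w - z)) holomorphic_on U"
        by (intro holomorphic_intros) (use U_nz in auto)
    qed (use U valid in \<open>auto simp: K_def\<close>)
    finally have "c * I2 N * (A N z / B N z) = (\<Sum>i<n. contour_integral (linepath (a i) (b i))
        (\<lambda>v. f v * contour_integral \<Gamma>2 (\<lambda>w. B N w / A N w / (w - z) / (v - w))) * (A N z / B N z))"
      by (simp only: sum_distrib_right)
    also have "\<dots> = (\<Sum>i<n. contour_integral (linepath (a i) (b i)) (\<lambda>v. G v * H v ^ N))"
    proof (intro sum.cong refl)
      fix i assume "i \<in> {..<n}"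
      then have i: "i < n" by simp
      have "contour_integral (linepath (a i) (b i))
          (\<lambda>v. f v * contour_integral \<Gamma>2 (\<lambda>w. B N w / A N w / (w - z) / (v - w))) =
        contour_integral (linepath (a i) (b i)) (\<lambda>v. G v * (B N v / A N v))"
      proof (rule contour_integral_cong[OF refl])
        fix x assume "x \<in> path_image (linepath (a i) (b i))"
        then have x: "x \<in> closed_segment (a i) (b i)" by simp
        have "contour_integral \<Gamma>2 (\<lambda>w. B N w / A N w / (w - z) / (x - w)) =
            - (c * winding_number \<Gamma>2 x * (B N x / A N x / (x - z)))"
          unfolding c_def using v(1-3)[OF i x] by (intro contour_integral_inner_kernel) auto
        then show "f x * contour_integral \<Gamma>2 (\<lambda>w. B N w / A N w / (w - z) / (x - w)) = G x * (B N x / A N x)"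
          by (simp only: G_def) (simp add: mult_ac)
      qed
      moreover have "(\<lambda>v. G v * (B N v / A N v)) contour_integrable_on linepath (a i) (b i)"
        by (intro contour_integrable_continuous_linepath continuous_on_mult G[OF i] E[OF i])
      then have "contour_integral (linepath (a i) (b i)) (\<lambda>v. G v * (B N v / A N v) * (A N z / B N z)) =
          contour_integral (linepath (a i) (b i)) (\<lambda>v. G v * (B N v / A N v)) * (A N z / B N z)"
        by (rule contour_integral_rmul)
      moreover have "(\<lambda>v. G v * (B N v / A N v) * (A N z / B N z)) = (\<lambda>v. G v * H v ^ N)"
        unfolding H_def by (subst (1 2 3 4) node_prod_power) (simp add: power_divide power_mult_distrib mult.assoc)
      ultimately show "contour_integral (linepath (a i) (b i))
          (\<lambda>v. f v * contour_integral \<Gamma>2 (\<lambda>w. B N w / A N w / (w - z) / (v - w))) * (A N z / B N z) =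
        contour_integral (linepath (a i) (b i)) (\<lambda>v. G v * H v ^ N)"
        by simp
    qed
    finally show ?thesis by (simp only: mult.assoc)
  qed
  have "(\<lambda>N. \<Sum>i<n. contour_integral (linepath (a i) (b i)) (\<lambda>v. G v * H v ^ N)) \<longlonglongrightarrow> 0"
  proof (rule tendsto_sum_contour_integral_power[OF G H, where \<theta> = "1 / \<rho> * (\<alpha> / \<beta>)"])
    fix i v assume i: "i < n" "v \<in> closed_segment (a i) (b i)"
    show "G v = 0 \<or> norm (H v) \<le> 1 / \<rho> * (\<alpha> / \<beta>)"
      using v(6)[OF i]
    proof
      assume "v \<in> Out2"
      then show ?thesis using winding_outside(2) by (simp add: G_def)
    next
      assume lt: "\<rho> * node_abs {q+1..p} pt \<mu> v < node_abs {1..q} pt \<mu> v"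
      have "0 \<le> node_abs {q+1..p} pt \<mu> v" by (simp flip: norm_node_prod)
      then have "0 \<le> \<rho> * node_abs {q+1..p} pt \<mu> v" using \<rho>0 by simp
      then have "0 < node_abs {1..q} pt \<mu> v" using lt by linarith
      then have "node_abs {q+1..p} pt \<mu> v / node_abs {1..q} pt \<mu> v \<le> 1 / \<rho>"
        using lt \<rho>0 by (simp add: field_simps)
      then show ?thesis
        unfolding H_def norm_divide norm_mult norm_node_prod \<alpha>_def[symmetric] \<beta>_def[symmetric]
        using \<alpha> \<beta> by (intro disjI2 mult_right_mono) auto
    qed
  qed (use \<rho> \<alpha> \<beta> \<rho>0 in \<open>auto simp: field_simps\<close>)
  then have "(\<lambda>N. c * (I2 N * (A N z / B N z))) \<longlonglongrightarrow> 0" unfolding eq .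
  from tendsto_mult[OF tendsto_const[of "1 / c"] this] show ?thesis using c by simp
qed

lemma remainder_tendsto_0:
  assumes "z \<in> conv_region \<Omega> \<Omega>0 pt \<mu> p q"
  shows "(\<lambda>N. remainder f \<Gamma>1 \<Gamma>2 pt \<mu> p q N z) \<longlonglongrightarrow> 0"
proof -
  have "(\<lambda>N. 1 / (2 * of_real pi * \<i>) * (I1 N * P N z - I2 N * (A N z / B N z))) \<longlonglongrightarrow>
      1 / (2 * of_real pi * \<i>) * (0 - 0)"
    using assms unfolding conv_region_def
    by (intro tendsto_mult tendsto_const tendsto_diff outer_integral_tendsto_0 inner_integral_tendsto_0) auto
  then show ?thesis by (simp only: remainder_eq) simp
qed

end

theorem theorem4p1:
  fixes \<Omega> \<Omega>0 :: "complex set" and f :: "complex \<Rightarrow> complex"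
    and pt :: "nat \<Rightarrow> complex" and \<mu> :: "nat \<Rightarrow> nat" and p q m s :: nat
  assumes "closed \<Omega>0" and "open \<Omega>" and "\<Omega>0 \<subseteq> \<Omega>"
    and "f analytic_on (\<Omega> - \<Omega>0)"
    and "p \<ge> 1" and "q \<le> p"
    and "inj_on pt {1..p}"
    and "\<forall>k\<in>{1..p}. \<mu> k \<ge> 1"
    and "pt ` {1..q} \<subseteq> \<Omega> - \<Omega>0" and "pt ` {q+1..p} \<subseteq> \<Omega>0"
    and "m = (\<Sum>k=1..p. \<mu> k)" and "s = (\<Sum>k=1..q. \<mu> k)"
  shows "\<forall>z \<in> \<Omega> - \<Omega>0. \<forall>\<Gamma>1 \<Gamma>2. admissible_loops \<Omega> \<Omega>0 pt q z \<Gamma>1 \<Gamma>2 \<longrightarrow>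
     (\<forall>N. f z =
        (\<Sum>n<N. poly (q_poly f \<Gamma>1 pt \<mu> p n) z * node_prod {1..p} pt \<mu> n z)
      + (\<Sum>n<N. poly (t1_poly f \<Gamma>2 pt \<mu> p q n) z *
           (node_prod {1..q} pt \<mu> n z / node_prod {q+1..p} pt \<mu> n z))
      + (\<Sum>n<N. poly (t2_poly f \<Gamma>2 pt \<mu> p q n) z *
           (node_prod {1..q} pt \<mu> (n + 1) z / node_prod {q+1..p} pt \<mu> (n + 1) z))
      + remainder f \<Gamma>1 \<Gamma>2 pt \<mu> p q N z) \<and>
     (\<forall>n. (q_poly f \<Gamma>1 pt \<mu> p n = 0 \<or> degree (q_poly f \<Gamma>1 pt \<mu> p n) < m) \<and>
          (t1_poly f \<Gamma>2 pt \<mu> p q n = 0 \<or> degree (t1_poly f \<Gamma>2 pt \<mu> p q n) < s) \<and>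
          (t2_poly f \<Gamma>2 pt \<mu> p q n = 0 \<or> degree (t2_poly f \<Gamma>2 pt \<mu> p q n) < m - s)) \<and>
     (z \<in> conv_region \<Omega> \<Omega>0 pt \<mu> p q \<longrightarrow>
        (\<lambda>N. remainder f \<Gamma>1 \<Gamma>2 pt \<mu> p q N z) \<longlonglongrightarrow> 0)"
proof (intro ballI allI impI conjI)
  fix z \<Gamma>1 \<Gamma>2 N
  assume z: "z \<in> \<Omega> - \<Omega>0" and adm: "admissible_loops \<Omega> \<Omega>0 pt q z \<Gamma>1 \<Gamma>2"
  interpret two_loop_expansion \<Omega> \<Omega>0 f pt \<mu> p q z \<Gamma>1 \<Gamma>2
    using assms z adm analytic_imp_holomorphic by unfold_locales auto
  show "f z =
        (\<Sum>n<N. poly (q_poly f \<Gamma>1 pt \<mu> p n) z * node_prod {1..p} pt \<mu> n z)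
      + (\<Sum>n<N. poly (t1_poly f \<Gamma>2 pt \<mu> p q n) z *
           (node_prod {1..q} pt \<mu> n z / node_prod {q+1..p} pt \<mu> n z))
      + (\<Sum>n<N. poly (t2_poly f \<Gamma>2 pt \<mu> p q n) z *
           (node_prod {1..q} pt \<mu> (n + 1) z / node_prod {q+1..p} pt \<mu> (n + 1) z))
      + remainder f \<Gamma>1 \<Gamma>2 pt \<mu> p q N z"
    by (rule expansion)
next
  fix z \<Gamma>1 \<Gamma>2 n
  show "q_poly f \<Gamma>1 pt \<mu> p n = 0 \<or> degree (q_poly f \<Gamma>1 pt \<mu> p n) < m"
    unfolding q_poly_def assms(11) by (rule degree_hermite_poly) (use assms(8) in auto)
  show "t1_poly f \<Gamma>2 pt \<mu> p q n = 0 \<or> degree (t1_poly f \<Gamma>2 pt \<mu> p q n) < s"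
    unfolding t1_poly_def assms(12) degree_minus neg_equal_0_iff_equal
    by (rule degree_hermite_poly) (use assms(6,8) in auto)
  have "{1..p} = {1..q} \<union> {q+1..p}" using assms(6) by auto
  \<comment> \<open>The truncated difference is the true one: the node indices split at
    \<open>q\<close>, so the inner multiplicities are exactly what remains.\<close>
  then have ms: "m - s = (\<Sum>k=q+1..p. \<mu> k)"
    unfolding assms(11,12) by (simp add: sum.union_disjoint)
  show "t2_poly f \<Gamma>2 pt \<mu> p q n = 0 \<or> degree (t2_poly f \<Gamma>2 pt \<mu> p q n) < m - s"
    unfolding t2_poly_def ms by (rule degree_hermite_poly) (use assms(8) in auto)
next
  fix z \<Gamma>1 \<Gamma>2
  assume z: "z \<in> \<Omega> - \<Omega>0" and adm: "admissible_loops \<Omega> \<Omega>0 pt q z \<Gamma>1 \<Gamma>2"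
    and conv: "z \<in> conv_region \<Omega> \<Omega>0 pt \<mu> p q"
  interpret two_loop_expansion \<Omega> \<Omega>0 f pt \<mu> p q z \<Gamma>1 \<Gamma>2
    using assms z adm analytic_imp_holomorphic by unfold_locales auto
  show "(\<lambda>N. remainder f \<Gamma>1 \<Gamma>2 pt \<mu> p q N z) \<longlonglongrightarrow> 0"
    by (rule remainder_tendsto_0[OF conv])
qed

end
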